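(* Let $\rho \ge 0$ be real. If $|\zeta(1/2+i\rho)| \neq 0$, then $|\zeta'(1/2+i\rho)| \neq 0$.
   Context: $\zeta$ is the Riemann zeta function (analytically continued), and $\zeta'(1/2+i\rho)$ is the value of its complex derivative $\zeta'(s)=d\zeta/ds$ at $s=1/2+i\rho$. *)

theory Defs
  imports "HOL-Complex_Analysis.Complex_Analysis"
begin

(* The value at the pole is set to 0, which makes the analytic continuation unique as a total
   function. For n >= 1, of_nat n powr (-s) is exp (- s * ln n), i.e. the usual n^(-s). *)
definition zeta :: "complex \<Rightarrow> complex" where
  "zeta = (THE f. f holomorphic_on (- {1}) \<and>
                  (\<forall>s. Re s > 1 \<longrightarrow> (\<lambda>n. of_nat (Suc n) powr (- s)) sums f s) \<and>
                  f 1 = 0)"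

end

theory Submission
  imports Defs "HOL-Real_Asymp.Real_Asymp"
begin

text \<open>
  Let \<open>A(s) = \<pi>\<^sup>-\<^sup>s\<^sup>/\<^sup>2 / \<Gamma>((1 - s)/2)\<close>. The functional equation says that \<open>\<zeta>(s) A(s)\<close> is invariant
  under \<open>s \<mapsto> 1 - s\<close>, so it is real on the critical line. Differentiating along the line at a
  zero of \<open>\<zeta>'\<close> that is not a zero of \<open>\<zeta>\<close> forces \<open>Re (A'/A) = 0\<close>, that is,
  \<open>Re \<psi>(1/4 - i\<rho>/2) = ln \<pi>\<close> for the digamma function \<open>\<psi>\<close>. Elementary bounds on \<open>Re \<psi>\<close> confine \<open>\<rho>\<close> to
  \<open>[6.16, 6.4]\<close>, and there \<open>\<zeta>'\<close> is bounded away from zero by Euler--Maclaurin summation with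
  explicit error terms.

  The functional equation is obtained for real \<open>s\<close> in \<open>(-1, 0)\<close> by evaluating the integral of
  \<open>(1/(e\<^sup>x - 1) - 1/x + 1/2) x\<^sup>s\<^sup>-\<^sup>1\<close> over the positive reals in two ways, from a geometric series and
  from the partial fractions of the hyperbolic cotangent.
\<close>

text \<open>The argument on the critical line cannot finish alone. Re \<psi>(1/4 - i\<rho>/2) is
  close to ln (\<rho>/2), so the equation with ln \<pi> really has a solution near \<rho> = 2\<pi>,
  and around that height only a numerical estimate of \<zeta>' remains.

  \<open>zeta\<close> is given by a definite description, so its values are accessible only once a
  function holomorphic off 1 has been constructed. Euler-Maclaurin summation with one Bernoulli
  correction yields such a function for Re s > -3 only. The rest of the plane is filled in by the
  functional equation, which is therefore proved for \<open>zeta_ext\<close> before anything is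
  known about \<open>zeta\<close>.

  The integral behind the functional equation is taken at real s in order to have nonnegative
  integrands throughout: sums and integrals are then exchanged in \<open>ennreal\<close> without any
  convergence estimate, and complex s is reached afterwards by the identity theorem.\<close>

section \<open>Analytic continuation by Euler--Maclaurin summation\<close>

text \<open>The Euler--Maclaurin corrections up to the term with the Bernoulli number \<open>B\<^sub>2\<close>.\<close>
definition zeta_em :: "nat \<Rightarrow> complex \<Rightarrow> complex" where
  "zeta_em N s = (\<Sum>n=1..<N. of_nat n powr (-s)) + of_nat N powr (-s) / 2
     + of_nat N powr (1 - s) / (s - 1) + s / 12 * of_nat N powr (-s - 1)"

text \<open>The limit exists for Re s > -3 away from 1. This reaches far enough to the left to
  contain the interval (-1, 0) of the Mellin argument and to overlap the half-plane Re s < 0 that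
  the functional equation covers. The index starts at 1 because the powers of N have no meaning as
  Euler-Maclaurin terms at N = 0.\<close>

definition zeta_ext :: "complex \<Rightarrow> complex" where
  "zeta_ext s = lim (\<lambda>N. zeta_em (Suc N) s)"

lemma zeta_em_Suc_diff:
  fixes s :: complex
  assumes "n \<ge> 1" and s1: "s \<noteq> 1" and sig: "Re s \<ge> -4"
  shows "norm (zeta_em (Suc n) s - zeta_em n s)
           \<le> norm (s * (s+1) * (s+2) * (s+3)) / 720 * real n powr (- Re s - 4)"
proof -
  define q where "q = s * (s+1) * (s+2) * (s+3)"
  \<comment> \<open>The fourth derivative of \<open>P\<close> is 1 and \<open>P\<close> has double zeros at 0 and 1, so integrating
    \<open>P\<close> times the fourth derivative of \<open>f\<close> by parts over a unit interval leaves exactly the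
    Euler--Maclaurin terms.\<close>
  define P where "P = (\<lambda>z::complex. z^2 * (1 - z)^2 / 24)"
  define P1 where "P1 = (\<lambda>z::complex. (2*z - 6*z^2 + 4*z^3) / 24)"
  define P2 where "P2 = (\<lambda>z::complex. (2 - 12*z + 12*z^2) / 24)"
  define P3 where "P3 = (\<lambda>z::complex. (24*z - 12) / 24)"
  define X where "X = (\<lambda>z::complex. of_nat n + z)"
  define f where "f = (\<lambda>z. X z powr (-s))"
  define f1 where "f1 = (\<lambda>z. (-s) * X z powr (-s - 1))"
  define f2 where "f2 = (\<lambda>z. s * (s+1) * X z powr (-s - 2))"
  define f3 where "f3 = (\<lambda>z. - (s * (s+1) * (s+2)) * X z powr (-s - 3))"
  define f4 where "f4 = (\<lambda>z. q * X z powr (-s - 4))"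
  define F where "F = (\<lambda>z. X z powr (1 - s) / (1 - s))"
  define D where "D = (\<lambda>z. P z * f3 z - P1 z * f2 z + P2 z * f1 z - P3 z * f z + F z)"
  have nz: "X (of_real u) \<notin> \<real>\<^sub>\<le>\<^sub>0" if "u \<in> {0..1}" for u
    using that assms by (auto simp: X_def complex_nonpos_Reals_iff)
  have dX: "(X has_field_derivative 1) (at z)" for z
    unfolding X_def by (auto intro!: derivative_eq_intros)
  have dpow: "((\<lambda>z. X z powr a) has_field_derivative a * X z powr (a - 1)) (at z)"
    if "X z \<notin> \<real>\<^sub>\<le>\<^sub>0" for a z
    using DERIV_chain2[OF has_field_derivative_powr[OF that] dX] by simp
  have df: "(f has_field_derivative f1 z) (at z)" if "X z \<notin> \<real>\<^sub>\<le>\<^sub>0" for z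
    unfolding f_def f1_def using dpow[OF that, of "-s"] by simp
  have df1: "(f1 has_field_derivative f2 z) (at z)" if "X z \<notin> \<real>\<^sub>\<le>\<^sub>0" for z
    unfolding f1_def f2_def using DERIV_cmult[OF dpow[OF that, of "-s - 1"], of "-s"]
    by (simp add: algebra_simps)
  have df2: "(f2 has_field_derivative f3 z) (at z)" if "X z \<notin> \<real>\<^sub>\<le>\<^sub>0" for z
    unfolding f3_def f2_def using DERIV_cmult[OF dpow[OF that, of "-s - 2"], of "s*(s+1)"]
    by (simp add: algebra_simps)
  have df3: "(f3 has_field_derivative f4 z) (at z)" if "X z \<notin> \<real>\<^sub>\<le>\<^sub>0" for z
    unfolding f3_def f4_def q_def 
    using DERIV_cmult[OF dpow[OF that, of "-s - 3"], of "- (s*(s+1)*(s+2))"]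
    by (simp add: algebra_simps)
  have dF: "(F has_field_derivative f z) (at z)" if "X z \<notin> \<real>\<^sub>\<le>\<^sub>0" for z
    unfolding F_def f_def using DERIV_cdivide[OF dpow[OF that, of "1 - s"], of "1 - s"] s1 by simp
  have dP: "(P has_field_derivative P1 z) (at z)" for z
    unfolding P_def P1_def
    by (auto intro!: derivative_eq_intros simp: field_simps power2_eq_square power3_eq_cube)
  have dP1: "(P1 has_field_derivative P2 z) (at z)" for z
    unfolding P1_def P2_def
    by (auto intro!: derivative_eq_intros simp: field_simps power2_eq_square power3_eq_cube)
  have dP2: "(P2 has_field_derivative P3 z) (at z)" for z
    unfolding P2_def P3_def
    by (auto intro!: derivative_eq_intros simp: field_simps power2_eq_square power3_eq_cube)
  have dP3: "(P3 has_field_derivative 1) (at z)" for z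
    unfolding P3_def by (rule derivative_eq_intros refl | simp)+
  have dD: "(D has_field_derivative P z * f4 z) (at z)" if "X z \<notin> \<real>\<^sub>\<le>\<^sub>0" for z
  proof -
    have "(D has_field_derivative
       (P1 z * f3 z + f4 z * P z - (P2 z * f2 z + f3 z * P1 z) + (P3 z * f1 z + f2 z * P2 z)
         - (1 * f z + f1 z * P3 z) + f z)) (at z)"
      unfolding D_def
      by (intro DERIV_add DERIV_diff DERIV_mult dP dP1 dP2 dP3 df df1 df2 df3 dF that)
    then show ?thesis by (simp add: algebra_simps)
  qed
  have int: "((\<lambda>u. P (of_real u) * f4 (of_real u)) has_integral (D (of_real 1) - D (of_real 0))) {0..1}"
    by (rule fundamental_theorem_of_calculus)
       (auto intro!: has_vector_derivative_real_field dD nz)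
  define K where "K = norm q * real n powr (- Re s - 4)"
  \<comment> \<open>\<open>p\<close> is |P| times \<open>K\<close>, a bound for the fourth
    derivative on the interval; it is taken at the left end since - Re s - 4 \<le> 0. The integral
    is (1/3 - 1/2 + 1/5)/24 * K = K/720.\<close>
  define p where "p = (\<lambda>u::real. (u^2 - 2*u^3 + u^4) / 24 * K)"
  have int2: "(p has_integral ((\<lambda>u. (u^3/3 - u^4/2 + u^5/5)/24*K) 1 - (\<lambda>u. (u^3/3 - u^4/2 + u^5/5)/24*K) 0)) {0..1}"
    unfolding p_def
    by (rule fundamental_theorem_of_calculus)
       (auto intro!: derivative_eq_intros simp flip: has_real_derivative_iff_has_vector_derivative simp: field_simps)
  have le: "norm (P (of_real u) * f4 (of_real u)) \<le> p u" if "u \<in> {0..1}" for u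
  proof -
    have "norm (P (of_real u)) = (u^2 - 2*u^3 + u^4) / 24"
    proof -
      have "P (of_real u) = of_real (u^2 * (1-u)^2/24)" unfolding P_def by simp
      then have "norm (P (of_real u)) = \<bar>u^2 * (1-u)^2/24\<bar>" by (simp only: norm_of_real)
      also have "\<dots> = u^2 * (1-u)^2/24" by simp
      finally show ?thesis by (simp add: power2_eq_square power3_eq_cube power4_eq_xxxx algebra_simps)
    qed
    moreover have "norm (f4 (of_real u)) \<le> K"
    proof -
      have "X (of_real u) = of_real (real n + u)" unfolding X_def by simp
      then have "norm (X (of_real u) powr (-s - 4)) = (real n + u) powr (- Re s - 4)"
        using that by (simp add: norm_powr_real_powr)
      also have "\<dots> \<le> real n powr (- Re s - 4)"
        using that assms by (intro powr_mono2') auto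
      finally show ?thesis unfolding f4_def K_def norm_mult by (intro mult_left_mono) auto
    qed
    ultimately show ?thesis unfolding p_def norm_mult
      by (smt (verit) mult_left_mono norm_ge_zero)
  qed
  have "norm (D (of_real 1) - D (of_real 0)) \<le> K / 720"
  proof -
    have "norm (integral {0..1} (\<lambda>u. P (of_real u) * f4 (of_real u))) \<le> integral {0..1} p"
      using int int2 le by (intro integral_norm_bound_integral) (auto simp: integrable_on_def)
    moreover have "integral {0..1} p = K/720" using integral_unique[OF int2] by simp
    ultimately show ?thesis using integral_unique[OF int] by simp
  qed
  moreover have "zeta_em (Suc n) s - zeta_em n s = - (D (of_real 1) - D (of_real 0))"
  proof -
    have "zeta_em (Suc n) s - zeta_em n s =
       (of_nat n powr (-s) + of_nat (Suc n) powr (-s))/2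
       + (of_nat (Suc n) powr (1 - s) - of_nat n powr (1 - s)) / (s - 1)
       + s/12 * (of_nat (Suc n) powr (-s - 1) - of_nat n powr (-s - 1))"
      unfolding zeta_em_def using assms(1)
      by (simp add: diff_divide_distrib algebra_simps)
    \<comment> \<open>At both ends \<open>P\<close> and \<open>P1\<close> vanish and
      \<open>P2\<close> is 1/12, while \<open>P3\<close> is -1/2 at 0 and 1/2 at 1. So only the
      trapezoid, integral and Bernoulli terms of \<open>D\<close> survive.\<close>
    also have "\<dots> = - (D (of_real 1) - D (of_real 0))"
    proof -
      have *: "A / (1 - s) = - (A / (s - 1))" for A
        using s1 by (simp add: field_simps)
      show ?thesis
        unfolding D_def P_def P1_def P2_def P3_def f_def f1_def F_def X_def *
        by (simp add: diff_divide_distrib algebra_simps)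
    qed
    finally show ?thesis .
  qed
  ultimately show ?thesis unfolding K_def q_def by (simp add: norm_minus_commute)
qed

lemma zeta_em_minus_zeta_em_sum:
  "zeta_em (N + k) s - zeta_em N s = (\<Sum>i<k. zeta_em (Suc (N + i)) s - zeta_em (N + i) s)"
  using sum_lessThan_telescope[of "\<lambda>i. zeta_em (N + i) s" k] by simp

lemma summable_zeta_em_diff:
  assumes "s \<noteq> 1" "Re s > -3" "N \<ge> 1"
  shows "summable (\<lambda>i. zeta_em (Suc (N + i)) s - zeta_em (N + i) s)"
proof (rule summable_comparison_test)
  have "summable (\<lambda>n. real n powr (- Re s - 4))"
    using assms by (subst summable_real_powr_iff) auto
  then have "summable (\<lambda>i. real (i + N) powr (- Re s - 4))"
    by (rule summable_ignore_initial_segment)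
  then show "summable (\<lambda>i. norm (s * (s+1) * (s+2) * (s+3)) / 720 * real (N + i) powr (- Re s - 4))"
    by (intro summable_mult) (simp add: add.commute)
  show "\<exists>M. \<forall>i\<ge>M. norm (zeta_em (Suc (N + i)) s - zeta_em (N + i) s)
      \<le> norm (s * (s+1) * (s+2) * (s+3)) / 720 * real (N + i) powr (- Re s - 4)"
    using assms by (intro exI[of _ 0] allI impI zeta_em_Suc_diff) auto
qed

lemma zeta_em_LIMSEQ:
  assumes "s \<noteq> 1" "Re s > -3"
  shows "(\<lambda>N. zeta_em (Suc N) s) \<longlonglongrightarrow> zeta_ext s"
proof -
  have "(\<lambda>k. (\<Sum>i<k. zeta_em (Suc (1 + i)) s - zeta_em (1 + i) s)) \<longlonglongrightarrow>
      (\<Sum>i. zeta_em (Suc (1 + i)) s - zeta_em (1 + i) s)"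
    using summable_zeta_em_diff[OF assms, of 1] by (simp add: summable_LIMSEQ)
  then have "convergent (\<lambda>k. zeta_em (1 + k) s - zeta_em 1 s + zeta_em 1 s)"
    unfolding zeta_em_minus_zeta_em_sum by (intro convergent_add) (auto simp: convergent_def)
  then show ?thesis unfolding zeta_ext_def by (simp add: convergent_LIMSEQ_iff)
qed

lemma zeta_ext_minus_zeta_em:
  assumes "s \<noteq> 1" "Re s > -3" "N \<ge> 1"
  shows "(\<lambda>i. zeta_em (Suc (N + i)) s - zeta_em (N + i) s) sums (zeta_ext s - zeta_em N s)"
proof -
  have "(\<lambda>k. zeta_em (Suc (k + (N - 1))) s - zeta_em N s) \<longlonglongrightarrow> zeta_ext s - zeta_em N s"
    by (intro tendsto_intros LIMSEQ_ignore_initial_segment[OF zeta_em_LIMSEQ] assms)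
  then show ?thesis using assms(3)
    unfolding sums_def zeta_em_minus_zeta_em_sum[symmetric] by (simp add: add.commute)
qed

lemma zeta_em_holomorphic:
  assumes "1 \<notin> S" "N \<ge> 1"
  shows "zeta_em N holomorphic_on S"
  unfolding zeta_em_def using assms by (intro holomorphic_intros) auto

lemma zeta_ext_holomorphic: "zeta_ext holomorphic_on ({s. Re s > -3} - {1})" 
proof (rule holomorphic_uniform_sequence)
  show op: "open ({s. Re s > -3} - {1})"
    by (intro open_Diff open_halfspace_Re_gt) auto
  show "\<And>N. zeta_em (Suc N) holomorphic_on ({s. Re s > -3} - {1})"
    by (intro zeta_em_holomorphic) auto
  fix x :: complex assume x: "x \<in> {s. Re s > -3} - {1}"
  obtain d where d: "d > 0" "cball x d \<subseteq> {s. Re s > -3} - {1}"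
    using op x open_contains_cball by blast
  define K where "K = cball x d"
  have K: "compact K" "K \<noteq> {}" and K': "\<And>s. s \<in> K \<Longrightarrow> Re s > -3 \<and> s \<noteq> 1"
    using d unfolding K_def by auto
  \<comment> \<open>For the M-test on the disc: \<open>s0\<close> has the least real part and
    \<open>s1\<close> below maximises the polynomial factor. The majorant built from them is
    summable because Re s0 > -3.\<close>
  obtain s0 where s0: "s0 \<in> K" "\<And>s. s \<in> K \<Longrightarrow> Re s0 \<le> Re s"
    using continuous_attains_inf[OF K continuous_on_Re[OF continuous_on_id]] by auto
  have "continuous_on K (\<lambda>s. norm (s * (s+1) * (s+2) * (s+3)) / 720)"
    by (intro continuous_intros) auto
  from continuous_attains_sup[OF K this] obtain s1 :: complex where
    s1: "\<And>s. s \<in> K \<Longrightarrow> norm (s * (s+1) * (s+2) * (s+3)) / 720 \<le> norm (s1 * (s1+1) * (s1+2) * (s1+3)) / 720"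
    by auto
  define C where "C = norm (s1 * (s1+1) * (s1+2) * (s1+3)) / 720"
  have sm: "summable (\<lambda>i. C * real (1 + i) powr (- Re s0 - 4))"
  proof -
    have "summable (\<lambda>n. real n powr (- Re s0 - 4))"
      using K'[OF s0(1)] by (subst summable_real_powr_iff) auto
    then have "summable (\<lambda>i. real (i + 1) powr (- Re s0 - 4))"
      by (rule summable_ignore_initial_segment)
    then show ?thesis by (intro summable_mult) (simp add: add.commute)
  qed
  have "uniform_limit K (\<lambda>k s. \<Sum>i<k. zeta_em (Suc (1 + i)) s - zeta_em (1 + i) s)
     (\<lambda>s. \<Sum>i. zeta_em (Suc (1 + i)) s - zeta_em (1 + i) s) sequentially"
  proof (rule Weierstrass_m_test[OF _ sm])
    fix i s assume s: "s \<in> K"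
    have "norm (zeta_em (Suc (1 + i)) s - zeta_em (1 + i) s)
        \<le> norm (s * (s+1) * (s+2) * (s+3)) / 720 * real (1 + i) powr (- Re s - 4)"
      using K'[OF s] by (intro zeta_em_Suc_diff) auto
    also have "\<dots> \<le> C * real (1 + i) powr (- Re s0 - 4)"
      using s1[OF s] s0(2)[OF s] unfolding C_def by (intro mult_mono powr_mono) auto
    finally show "norm (zeta_em (Suc (1 + i)) s - zeta_em (1 + i) s) \<le> C * real (1 + i) powr (- Re s0 - 4)" .
  qed
  then have "uniform_limit K (\<lambda>k s. (zeta_em (1 + k) s - zeta_em 1 s) + zeta_em 1 s)
     (\<lambda>s. (\<Sum>i. zeta_em (Suc (1 + i)) s - zeta_em (1 + i) s) + zeta_em 1 s) sequentially"
    unfolding zeta_em_minus_zeta_em_sum by (intro uniform_limit_add uniform_limit_const)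
  then have "uniform_limit K (\<lambda>k s. zeta_em (Suc k) s) zeta_ext sequentially"
    by (rule uniform_limit_cong[THEN iffD1, rotated -1])
       (use zeta_ext_minus_zeta_em[of _ 1] K' in \<open>auto simp: sums_iff\<close>)
  then show "\<exists>d>0. cball x d \<subseteq> {s. - 3 < Re s} - {1} \<and>
             uniform_limit (cball x d) (\<lambda>N. zeta_em (Suc N)) zeta_ext sequentially"
    using d K_def by blast
qed

lemma zeta_ext_cnj:
  assumes "s \<noteq> 1" "Re s > -3"
  shows "zeta_ext (cnj s) = cnj (zeta_ext s)"
proof -
  have "cnj (zeta_em N s) = zeta_em N (cnj s)" if "N \<ge> 1" for N
    unfolding zeta_em_def by (simp add: cnj_powr)
  then have "(\<lambda>N. zeta_em (Suc N) (cnj s)) \<longlonglongrightarrow> cnj (zeta_ext s)"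
    using tendsto_cnj[OF zeta_em_LIMSEQ[OF assms]] by simp
  moreover have "(\<lambda>N. zeta_em (Suc N) (cnj s)) \<longlonglongrightarrow> zeta_ext (cnj s)"
    using assms by (intro zeta_em_LIMSEQ) (auto simp: complex_eq_iff)
  ultimately show ?thesis using LIMSEQ_unique by blast
qed

lemma of_nat_powr_tendsto_0:
  assumes "Re a < 0"
  shows "(\<lambda>N. of_nat (Suc N) powr a :: complex) \<longlonglongrightarrow> 0"
proof (rule Lim_null_comparison)
  have *: "norm (of_nat (Suc N) powr a :: complex) = real (Suc N) powr Re a" for N
    using norm_powr_real_powr[of "of_nat (Suc N)" a] by simp
  show "\<forall>\<^sub>F N in sequentially. norm (of_nat (Suc N) powr a :: complex) \<le> real (Suc N) powr Re a"
    unfolding * by simp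
  show "(\<lambda>N. real (Suc N) powr Re a) \<longlonglongrightarrow> 0"
    using assms by (intro LIMSEQ_Suc[of "\<lambda>N. real N powr Re a"] tendsto_neg_powr filterlim_real_sequentially)
qed

lemma zeta_ext_sums:
  assumes "Re s > 1"
  shows "(\<lambda>n. of_nat (Suc n) powr (- s)) sums zeta_ext s"
proof -
  have ne: "s \<noteq> 1" using assms by auto
  have "(\<lambda>N. zeta_em (Suc N) s - (of_nat (Suc N) powr (-s) / 2
     + of_nat (Suc N) powr (1 - s) / (s - 1) + s / 12 * of_nat (Suc N) powr (-s - 1)))
      \<longlonglongrightarrow> zeta_ext s - (0 / 2 + 0 / (s - 1) + s / 12 * 0)"
    using assms ne by (intro tendsto_intros zeta_em_LIMSEQ of_nat_powr_tendsto_0) auto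
  also have "(\<lambda>N. zeta_em (Suc N) s - (of_nat (Suc N) powr (-s) / 2
     + of_nat (Suc N) powr (1 - s) / (s - 1) + s / 12 * of_nat (Suc N) powr (-s - 1)))
     = (\<lambda>N. \<Sum>n<N. of_nat (Suc n) powr (- s))"
    unfolding zeta_em_def
    by (auto simp: fun_eq_iff sum.atLeast1_atMost_eq atLeastLessThanSuc_atLeastAtMost)
  finally show ?thesis unfolding sums_def by simp
qed

text \<open>The sum of n^(-4) over n \<ge> N is compared with a telescoping sum: by convexity,
  x^(-4) is at most the integral of t^(-4) over [x - 1/2, x + 1/2], which is the difference of 1/(3
  t^3) at the ends. Hence the half-integer in the bound, and 2160 = 3 * 720.\<close>

lemma zeta_ext_tail:
  assumes "Re s \<ge> 0" "s \<noteq> 1" "N \<ge> 1"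
  shows "norm (zeta_ext s - zeta_em N s)
     \<le> norm (s * (s+1) * (s+2) * (s+3)) / (2160 * (real N - 1/2)^3)"
proof -
  define C where "C = norm (s * (s+1) * (s+2) * (s+3)) / 720"
  define g where "g = (\<lambda>i. 1 / (3 * (real (N + i) - 1/2)^3))"
  have lim: "g \<longlonglongrightarrow> 0"
    unfolding g_def by real_asymp
  have s: "(\<lambda>i. C * (g i - g (Suc i))) sums (C * (g 0 - 0))"
    by (intro sums_mult telescope_sums' lim)
  have "norm (zeta_ext s - zeta_em N s) \<le> C * (g 0 - 0)"
  proof (rule norm_sums_le[OF zeta_ext_minus_zeta_em s])
    fix i
    define x where "x = real (N + i)"
    have x: "x \<ge> 1" unfolding x_def using assms by simp
    have "norm (zeta_em (Suc (N + i)) s - zeta_em (N + i) s) \<le> C * x powr (- Re s - 4)"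
      unfolding C_def x_def using assms by (intro zeta_em_Suc_diff) auto
    also have "x powr (- Re s - 4) \<le> x powr (-4)"
      using x assms by (intro powr_mono) auto
    also have "x powr (-4) = 1 / x^4"
      using x by (simp add: powr_minus powr_numeral field_simps)
    also have "1 / x^4 \<le> 1 / (3 * (x - 1/2)^3) - 1 / (3 * (x + 1/2)^3)"
    proof -
      have "1 / (3 * (x - 1/2)^3) - 1 / (3 * (x + 1/2)^3) = (x^2 + 1/12) / (x^2 - 1/4)^3"
      proof -
        have "1 / (3 * (x - 1/2)^3) - 1 / (3 * (x + 1/2)^3) =
           ((x + 1/2)^3 - (x - 1/2)^3) / (3 * ((x - 1/2) * (x + 1/2))^3)"
          using x unfolding power_mult_distrib by (simp add: field_simps)
        also have "(x + 1/2)^3 - (x - 1/2)^3 = 3 * (x^2 + 1/12)"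
          by (simp add: power3_eq_cube power2_eq_square algebra_simps)
        also have "3 * (x^2 + 1/12) / (3 * ((x - 1/2) * (x + 1/2))^3)
            = (x^2 + 1/12) / ((x - 1/2) * (x + 1/2))^3"
          by (rule mult_divide_mult_cancel_left) simp
        also have "(x - 1/2) * (x + 1/2) = x^2 - 1/4"
          by (simp add: power2_eq_square algebra_simps)
        finally show ?thesis .
      qed
      moreover have "1 / x^4 \<le> (x^2 + 1/12) / (x^2 - 1/4)^3"
      proof -
        have x2: "x^2 \<ge> 1" using x by simp
        have "(x^2 - 1/4)^3 \<le> (x^2)^3" using x2 by (intro power_mono) auto
        also have "\<dots> \<le> (x^2 + 1/12) * x^4" by (simp add: algebra_simps flip: power_add)
        finally have "(x^2 - 1/4)^3 \<le> (x^2 + 1/12) * x^4" .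
        moreover have "x^2 - 1/4 > 0" "x^4 > 0" using x x2 by (linarith, simp)
        then have "(x^2 - 1/4)^3 > 0" "x^4 > 0" by (auto intro: zero_less_power)
        ultimately show ?thesis by (simp add: divide_le_eq le_divide_eq mult.commute)
      qed
      ultimately show ?thesis by simp
    qed
    finally show "norm (zeta_em (Suc (N + i)) s - zeta_em (N + i) s) \<le> C * (g i - g (Suc i))"
      unfolding g_def x_def C_def by (simp add: mult_left_mono add.commute)
  qed (use assms in auto)
  also have "C * (g 0 - 0) = norm (s * (s+1) * (s+2) * (s+3)) / (2160 * (real N - 1/2)^3)"
    unfolding C_def g_def by simp
  finally show ?thesis .
qed

section \<open>A Mellin integral evaluated in two ways\<close>

text \<open>Logarithmic differentiation of rGamma z * rGamma (1 - z) = sin (\<pi> z) / \<pi>, stated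
  with the sine multiplied out.\<close>

lemma Digamma_reflection:
  fixes z :: complex
  assumes "z \<notin> \<int>"
  shows "(Digamma (1 - z) - Digamma z) * sin (of_real pi * z) = of_real pi * cos (of_real pi * z)"
proof -
  have z: "z \<notin> \<int>\<^sub>\<le>\<^sub>0" "1 - z \<notin> \<int>\<^sub>\<le>\<^sub>0"
  proof -
    show "z \<notin> \<int>\<^sub>\<le>\<^sub>0" using assms by (auto elim!: nonpos_Ints_cases)
    have "1 - (1 - z) \<in> \<int>" if "1 - z \<in> \<int>\<^sub>\<le>\<^sub>0"
    proof (rule Ints_diff)
      show "1 - z \<in> \<int>" using that by (rule nonpos_Ints_cases) simp
    qed simp
    then show "1 - z \<notin> \<int>\<^sub>\<le>\<^sub>0" using assms by auto
  qed
  have "((\<lambda>z. rGamma z * rGamma (1 - z)) has_field_derivative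
          ((- rGamma z * Digamma z) * rGamma (1 - z) + (- rGamma (1 - z) * Digamma (1 - z)) * (-1) * rGamma z)) (at z)"
    using z by (auto intro!: derivative_eq_intros)
  moreover have "((\<lambda>z. sin (of_real pi * z) / of_real pi) has_field_derivative cos (of_real pi * z)) (at z)"
    by (auto intro!: derivative_eq_intros)
  ultimately have "(- rGamma z * Digamma z) * rGamma (1 - z) + (- rGamma (1 - z) * Digamma (1 - z)) * (-1) * rGamma z
      = cos (of_real pi * z)"
    unfolding rGamma_reflection_complex by (rule DERIV_unique)
  then have "(rGamma z * rGamma (1 - z)) * (Digamma (1 - z) - Digamma z) = cos (of_real pi * z)"
    by (simp add: algebra_simps)
  then show ?thesis unfolding rGamma_reflection_complex by (simp add: field_simps)
qed

text \<open>The reflection formula at z = iy. The imaginary parts of the two digamma series pair the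
  terms \<open>b n\<close> and \<open>b (Suc n)\<close>, so their sum counts every term twice except
  \<open>b 0\<close> = 1/y; this is where the 1/y and the factor 1/2 come from.\<close>

lemma coth_partial_fractions:
  fixes y :: real
  assumes "y > 0"
  shows "(\<lambda>n. y / ((real n + 1)^2 + y^2)) sums ((pi * cosh (pi * y) / sinh (pi * y) - 1 / y) / 2)"
proof -
  define z where "z = \<i> * of_real y"
  define b where "b = (\<lambda>n. y / ((real n)^2 + y^2))"
  have z: "z \<notin> \<int>" using assms by (auto simp: z_def complex_eq_iff elim!: Ints_cases)
  have ne: "z \<noteq> 0" "1 - z \<noteq> 0" using assms by (auto simp: z_def complex_eq_iff)
  have "Digamma w + euler_mascheroni = (\<Sum>n. inverse (of_nat (Suc n)) - inverse (w + of_nat n))" for w :: complex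
    by (simp add: Digamma_def)
  then have dig: "(\<lambda>n. inverse (of_nat (Suc n)) - inverse (w + of_nat n)) sums (Digamma w + euler_mascheroni)"
    if "w \<noteq> 0" for w :: complex
    using summable_sums[OF summable_Digamma[OF that]] by simp
  have "(\<lambda>n. inverse (z + of_nat n) - inverse (1 - z + of_nat n)) sums (Digamma (1 - z) - Digamma z)"
    using sums_diff[OF dig[OF ne(2)] dig[OF ne(1)]] by simp
  from sums_Im[OF this] have "(\<lambda>n. Im (inverse (z + of_nat n)) - Im (inverse (1 - z + of_nat n)))
        sums Im (Digamma (1 - z) - Digamma z)" by simp
  also have "(\<lambda>n. Im (inverse (z + of_nat n)) - Im (inverse (1 - z + of_nat n))) = (\<lambda>n. - (b n + b (Suc n)))"
    by (simp add: fun_eq_iff z_def b_def add.commute diff_divide_distrib)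
  finally have "(\<lambda>n. - (b n + b (Suc n))) sums Im (Digamma (1 - z) - Digamma z)" .
  from sums_minus[OF this] have s: "(\<lambda>n. b n + b (Suc n)) sums - Im (Digamma (1 - z) - Digamma z)"
    by (simp only: minus_minus)
  have b0: "b n \<ge> 0" for n using assms by (simp add: b_def)
  have "summable b"
    using sums_summable[OF s] by (rule summable_comparison_test'[where N=0]) (use b0 in auto)
  then have sb: "summable (\<lambda>n. b (Suc n))" by (simp add: summable_Suc_iff)
  have "(\<Sum>n. b n + b (Suc n)) = (\<Sum>n. b n) + (\<Sum>n. b (Suc n))"
    using \<open>summable b\<close> sb by (rule suminf_add[symmetric])
  also have "\<dots> = b 0 + 2 * (\<Sum>n. b (Suc n))"
    using suminf_split_head[OF \<open>summable b\<close>] by simp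
  finally have 1: "- Im (Digamma (1 - z) - Digamma z) = 1/y + 2 * (\<Sum>n. b (Suc n))"
    using sums_unique[OF s] assms by (simp add: b_def power2_eq_square)
  have sh: "sinh (pi * y) > 0" using assms by simp
  have ex: "exp (complex_of_real (pi * y)) = of_real (exp (pi * y))" 
    "exp (- complex_of_real (pi * y)) = of_real (exp (- (pi * y)))"
    by (simp_all flip: exp_of_real)
  have cs: "cos (of_real pi * z) = of_real (cosh (pi * y))" "sin (of_real pi * z) = \<i> * of_real (sinh (pi * y))"
  proof -
    have *: "of_real pi * z = \<i> * of_real (pi * y)" by (simp add: z_def)
    have "cosh (complex_of_real (pi * y)) = of_real (cosh (pi * y))"
      "sinh (complex_of_real (pi * y)) = of_real (sinh (pi * y))"
      unfolding cosh_def sinh_def ex by (simp_all add: scaleR_conv_of_real)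
    moreover have "sin w = \<i> * (- \<i> * sin w)" for w by simp
    ultimately show "cos (of_real pi * z) = of_real (cosh (pi * y))" "sin (of_real pi * z) = \<i> * of_real (sinh (pi * y))"
      unfolding * cosh_conv_cos sinh_conv_sin by metis+
  qed
  have "(Digamma (1 - z) - Digamma z) = - \<i> * of_real (pi * cosh (pi * y) / sinh (pi * y))"
  proof -
    have S: "complex_of_real (sinh (pi * y)) \<noteq> 0" using sh by (simp only: of_real_eq_0_iff)
    have "D = - \<i> * ((D * (\<i> * S)) / S)" if "S \<noteq> 0" for D S :: complex
      using that by (simp add: algebra_simps)
    from this[OF S, of "Digamma (1 - z) - Digamma z"] show ?thesis
      unfolding Digamma_reflection[OF z, unfolded cs] by simp
  qed
  then have "- Im (Digamma (1 - z) - Digamma z) = pi * cosh (pi * y) / sinh (pi * y)" by simp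
  with 1 have "(\<Sum>n. b (Suc n)) = (pi * cosh (pi * y) / sinh (pi * y) - 1 / y) / 2" by (simp add: field_simps)
  with summable_sums[OF sb] have "(\<lambda>n. b (Suc n)) sums ((pi * cosh (pi * y) / sinh (pi * y) - 1 / y) / 2)"
    by (simp only:)
  then show ?thesis by (simp add: b_def add.commute)
qed

text \<open>The two leading terms 1/x - 1/2 of 1/(exp x - 1) at 0 are removed. What is left behaves
  like x/12 at 0 and tends to 1/2 at infinity, so against x^(s-1) it is integrable exactly for -1 <
  s < 0.\<close>

definition planck :: "real \<Rightarrow> real" where
  "planck x = 1 / (exp x - 1) - 1 / x + 1 / 2"

text \<open>Since \<open>planck x\<close> = coth (x/2) / 2 - 1/x, this is
  \<open>coth_partial_fractions\<close> at y = x/(2\<pi>), divided by \<pi>. It also makes the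
  positivity of \<open>planck\<close> visible.\<close>

lemma planck_partial_fractions:
  assumes "x > 0"
  shows "(\<lambda>n. 2 * x / (x^2 + (2 * pi * (real n + 1))^2)) sums planck x"
proof -
  define y where "y = x / (2 * pi)"
  have y: "y > 0" using assms by (simp add: y_def)
  have "(\<lambda>n. y / ((real n + 1)^2 + y^2) / pi) sums ((pi * cosh (pi * y) / sinh (pi * y) - 1 / y) / 2 / pi)"
    by (intro sums_divide coth_partial_fractions y)
  also have "(\<lambda>n. y / ((real n + 1)^2 + y^2) / pi) = (\<lambda>n. 2 * x / (x^2 + (2 * pi * (real n + 1))^2))"
  proof
    fix n
    have p: "x^2 + (2 * pi * (real n + 1))^2 > 0" using assms by (intro add_pos_nonneg) auto
    have "(real n + 1)^2 + y^2 = (x^2 + (2 * pi * (real n + 1))^2) / (4 * pi^2)"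
      unfolding y_def power_divide power_mult_distrib by (simp add: field_simps)
    then show "y / ((real n + 1)^2 + y^2) / pi = 2 * x / (x^2 + (2 * pi * (real n + 1))^2)"
      by (simp add: y_def power2_eq_square)
  qed
  also have "(pi * cosh (pi * y) / sinh (pi * y) - 1 / y) / 2 / pi = planck x"
  proof -
    have 1: "pi * y = x / 2" by (simp add: y_def)
    define e where "e = exp (x / 2)"
    have e: "e > 1" "exp x = e^2" using assms by (auto simp: e_def simp flip: exp_double)
    have "cosh (x/2) / sinh (x/2) = (e + 1/e) / (e - 1/e)"
    proof -
      have cs: "cosh (x/2) = (e + 1/e) / 2" "sinh (x/2) = (e - 1/e) / 2"
        by (simp_all add: cosh_def sinh_def e_def exp_minus inverse_eq_divide)
      have "(a / 2) / (b / 2) = a / b" for a b :: real by simp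
      then show ?thesis unfolding cs .
    qed
    also have "\<dots> = (e^2 + 1) / (e^2 - 1)" 
    proof -
      have "e + 1/e = (e^2 + 1) / e" "e - 1/e = (e^2 - 1) / e"
        using e(1) by (simp_all add: field_simps power2_eq_square)
      then show ?thesis using e(1) by simp
    qed
    also have "\<dots> = 1 + 2 / (e^2 - 1)"
    proof -
      have "E > 1 \<Longrightarrow> (E + 1) / (E - 1) = 1 + 2 / (E - 1)" for E :: real by (simp add: field_simps)
      then show ?thesis using e(1) by (simp add: one_less_power)
    qed
    finally have "cosh (x/2) / sinh (x/2) = 1 + 2 / (exp x - 1)" using e(2) by simp
    moreover have "(pi * cosh (pi * y) / sinh (pi * y) - 1 / y) / 2 / pi = (cosh (x/2) / sinh (x/2)) / 2 - 1 / x"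
      unfolding 1 using assms by (simp add: y_def field_simps)
    ultimately show ?thesis by (simp add: planck_def)
  qed
  finally show ?thesis .
qed

section \<open>Gamma integrals as nonnegative Lebesgue integrals\<close>

lemma nn_integral_Gamma_scaled:
  fixes a c :: real
  assumes "a > 0" "c > 0"
  shows "(\<integral>\<^sup>+x\<in>{0<..}. ennreal (x powr (a - 1) * exp (- c * x)) \<partial>lborel) = ennreal (Gamma a * c powr (-a))"
proof -
  let ?I = "\<integral>\<^sup>+x\<in>{0<..}. ennreal (x powr (a - 1) * exp (- c * x)) \<partial>lborel"
  have "ennreal (Gamma a) = (\<integral>\<^sup>+x. ennreal (indicator {0..} x * x powr (a - 1) / exp x) \<partial>lborel)"
    by (rule Gamma_conv_nn_integral_real) fact
  also have "\<dots> = ennreal c * (\<integral>\<^sup>+x. ennreal (indicator {0..} (c * x) * (c * x) powr (a - 1) / exp (c * x)) \<partial>lborel)"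
    using assms by (subst nn_integral_real_affine[of _ c 0]) auto
  also have "\<dots> = ennreal c * (\<integral>\<^sup>+x. ennreal (c powr (a - 1)) * (ennreal (x powr (a - 1) * exp (- c * x)) * indicator {0<..} x) \<partial>lborel)"
    using assms
    by (intro arg_cong2[where f="(*)"] refl nn_integral_cong)
       (auto simp: indicator_def zero_le_mult_iff powr_mult exp_minus field_simps simp flip: ennreal_mult')
  also have "\<dots> = ennreal c * (ennreal (c powr (a - 1)) * ?I)"
    by (subst nn_integral_cmult) auto
  also have "\<dots> = ennreal (c powr a) * ?I"
    using assms by (simp add: powr_diff mult.assoc[symmetric] flip: ennreal_mult')
  finally have "ennreal (c powr (-a)) * ennreal (Gamma a) = (ennreal (c powr (-a)) * ennreal (c powr a)) * ?I"
    by (simp add: mult.assoc)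
  moreover have "ennreal (c powr (-a)) * ennreal (c powr a) = 1"
    using assms by (simp flip: ennreal_mult' powr_add)
  ultimately show ?thesis using assms by (simp add: ennreal_mult' mult.commute)
qed

text \<open>Substitution y = x^2 in the Gamma integral. The rule
  \<open>nn_integral_substitution\<close> concerns compact intervals, so the half-line is exhausted
  by [0, m], mapped to [0, m^2], and monotone convergence gives the limit.\<close>

lemma nn_integral_Gamma_square:
  fixes s v :: real
  assumes "s > -1" "v > 0"
  shows "(\<integral>\<^sup>+x\<in>{0<..}. ennreal (x powr s * exp (- v * x^2)) \<partial>lborel)
     = ennreal (Gamma ((s+1)/2) / 2 * v powr (-((s+1)/2)))"
proof -
  define f where "f = (\<lambda>y::real. y powr ((s-1)/2) * exp (- v * y) / 2)"
  have f[measurable]: "f \<in> borel_measurable borel" unfolding f_def by measurable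
  have sub: "(\<integral>\<^sup>+x. ennreal (f x * indicator {0..(real m)^2} x) \<partial>lborel)
        = (\<integral>\<^sup>+x. ennreal (f (x^2) * (2 * x) * indicator {0..real m} x) \<partial>lborel)" for m
  proof -
    have "(\<integral>\<^sup>+x. ennreal (f x) * indicator {0^2..(real m)^2} x \<partial>lborel)
        = (\<integral>\<^sup>+x. ennreal (f (x^2) * (2 * x)) * indicator {0..real m} x \<partial>lborel)"
    proof -
      have "(\<integral>\<^sup>+x. ennreal (f x * indicator {(\<lambda>x. x^2) 0..(\<lambda>x. x^2) (real m)} x) \<partial>lborel)
        = (\<integral>\<^sup>+x. ennreal (f (x^2) * (2 * x) * indicator {0..real m} x) \<partial>lborel)"
        by (rule nn_integral_substitution)
           (auto simp: set_borel_measurable_def intro!: derivative_eq_intros continuous_intros)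
      then show ?thesis by (simp add: ennreal_mult'' ennreal_indicator)
    qed
    then show ?thesis by (simp add: ennreal_mult'' ennreal_indicator)
  qed
  \<comment> \<open>The intervals on the right contain 0 and the half-line on the left does not;
    \<open>g 0 = 0\<close> reconciles them. For \<open>f\<close>, which may blow up at 0, it comes
    from the convention \<open>0 powr a = 0\<close>.\<close>
  have sup: "(\<integral>\<^sup>+x\<in>{0<..}. ennreal (g x) \<partial>lborel) = (SUP m. (\<integral>\<^sup>+x. ennreal (g x * indicator {0..b m} x) \<partial>lborel))"
    if [measurable]: "g \<in> borel_measurable borel" and "\<And>x. x \<ge> 0 \<Longrightarrow> g x \<ge> 0" and g0: "g 0 = 0"
      and b: "incseq b" "filterlim b at_top sequentially" 
    for g :: "real \<Rightarrow> real" and b :: "nat \<Rightarrow> real"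
  proof -
    have "(\<integral>\<^sup>+x\<in>{0<..}. ennreal (g x) \<partial>lborel) = (\<integral>\<^sup>+x. (SUP m. ennreal (g x * indicator {0..b m} x)) \<partial>lborel)"
    proof (rule nn_integral_cong)
      fix x :: real
      show "ennreal (g x) * indicator {0<..} x = (SUP m. ennreal (g x * indicator {0..b m} x))"
      proof (cases "x > 0")
        case True
        obtain m where m: "x \<le> b m" using b(2) unfolding filterlim_at_top eventually_sequentially by blast
        have "(SUP m. ennreal (g x * indicator {0..b m} x)) = ennreal (g x)"
        proof (rule antisym)
          show "(SUP m. ennreal (g x * indicator {0..b m} x)) \<le> ennreal (g x)"
            by (intro SUP_least) (auto simp: indicator_def)
          show "ennreal (g x) \<le> (SUP m. ennreal (g x * indicator {0..b m} x))"
            using True m by (intro SUP_upper2[of m]) auto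
        qed
        then show ?thesis using True by simp
      next
        case False
        then have eq: "(\<lambda>m. ennreal (g x * indicator {0..b m} x)) = (\<lambda>m. 0)"
          by (cases "x = 0") (auto simp: g0)
        show ?thesis unfolding eq using False by simp
      qed
    qed
    also have "\<dots> = (SUP m. (\<integral>\<^sup>+x. ennreal (g x * indicator {0..b m} x) \<partial>lborel))"
    proof (rule nn_integral_monotone_convergence_SUP)
      show "incseq (\<lambda>m x. ennreal (g x * indicator {0..b m} x))"
        using that(2) b(1) by (auto simp: incseq_def le_fun_def indicator_def intro!: ennreal_leI) (meson order_trans)
    qed auto
    finally show ?thesis .
  qed
  have "(\<integral>\<^sup>+x\<in>{0<..}. ennreal (x powr s * exp (- v * x^2)) \<partial>lborel) =
     (\<integral>\<^sup>+x\<in>{0<..}. ennreal (f (x^2) * (2 * x)) \<partial>lborel)"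
  proof (rule nn_integral_cong)
    fix x :: real
    show "ennreal (x powr s * exp (- v * x^2)) * indicator {0<..} x = ennreal (f (x^2) * (2 * x)) * indicator {0<..} x"
    proof (cases "x > 0")
      case True
      define r where "r = (s-1)/2"
      have "(x^2) powr r * x = x powr (2 * r) * x"
        using True powr_powr[of x 2 r] by (simp add: powr_numeral)
      also have "2 * r = s - 1" by (simp add: r_def)
      also have "x powr (s - 1) * x = x powr s"
        using True by (simp add: powr_diff)
      finally have "(x^2) powr ((s-1)/2) * x = x powr s" unfolding r_def .
      then show ?thesis using True by (simp add: f_def algebra_simps)
    qed simp
  qed
  also have "\<dots> = (SUP m. (\<integral>\<^sup>+x. ennreal (f (x^2) * (2 * x) * indicator {0..real m} x) \<partial>lborel))"
    by (rule sup) (auto simp: f_def incseq_def filterlim_real_sequentially)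
  also have "\<dots> = (SUP m. (\<integral>\<^sup>+x. ennreal (f x * indicator {0..(real m)^2} x) \<partial>lborel))"
    unfolding sub ..
  also have "\<dots> = (\<integral>\<^sup>+x\<in>{0<..}. ennreal (f x) \<partial>lborel)"
  proof (rule sup[symmetric])
    show "filterlim (\<lambda>m. (real m)\<^sup>2) at_top sequentially" by real_asymp
  qed (auto simp: f_def incseq_def intro!: power_mono)
  also have "\<dots> = (\<integral>\<^sup>+x. ennreal (1/2) * (ennreal (x powr ((s+1)/2 - 1) * exp (- v * x)) * indicator {0<..} x) \<partial>lborel)"
  proof (rule nn_integral_cong)
    fix x :: real
    have "f x = 1/2 * (x powr ((s+1)/2 - 1) * exp (- v * x))"
      by (simp add: f_def field_simps)
    then show "ennreal (f x) * indicator {0<..} x =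
        ennreal (1/2) * (ennreal (x powr ((s+1)/2 - 1) * exp (- v * x)) * indicator {0<..} x)"
      by (simp only: ennreal_mult'[of "1/2"] mult.assoc)
  qed
  also have "\<dots> = ennreal (1/2) * ennreal (Gamma ((s+1)/2) * v powr (-((s+1)/2)))"
    using nn_integral_Gamma_scaled[of "(s+1)/2" v] assms by (subst nn_integral_cmult) auto
  also have "\<dots> = ennreal (1/2 * (Gamma ((s+1)/2) * v powr (-((s+1)/2))))"
    by (rule ennreal_mult'[symmetric]) simp
  finally show ?thesis by simp
qed

lemma nn_integral_exp_scaled:
  assumes "c > (0::real)"
  shows "(\<integral>\<^sup>+v\<in>{0<..}. ennreal (exp (- c * v)) \<partial>lborel) = ennreal (1 / c)"
proof -
  have "(\<integral>\<^sup>+v\<in>{0<..}. ennreal (exp (- c * v)) \<partial>lborel)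
     = (\<integral>\<^sup>+v\<in>{0<..}. ennreal (v powr (1 - 1) * exp (- c * v)) \<partial>lborel)"
    by (intro nn_integral_cong) (auto simp: indicator_def)
  then show ?thesis using nn_integral_Gamma_scaled[of 1 c] assms
    by (simp add: powr_minus field_simps)
qed

text \<open>Writing 1/(x^2 + b^2) as the integral of exp (-(x^2 + b^2) v) over v > 0 and integrating
  in x first leaves two Gamma integrals; -1 < s < 1 makes both Gamma arguments positive.\<close>

lemma nn_integral_powr_over_square:
  fixes s b :: real
  assumes s: "-1 < s" "s < 1" and b: "b > 0"
  shows "(\<integral>\<^sup>+x\<in>{0<..}. ennreal (x powr s / (x^2 + b^2)) \<partial>lborel)
     = ennreal (Gamma ((1+s)/2) * Gamma ((1-s)/2) / 2 * b powr (s - 1))"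
proof -
  have "(\<integral>\<^sup>+x\<in>{0<..}. ennreal (x powr s / (x^2 + b^2)) \<partial>lborel)
     = (\<integral>\<^sup>+x. (\<integral>\<^sup>+v. ennreal (x powr s * exp (- (x^2 + b^2) * v)) * indicator {0<..} x * indicator {0<..} v \<partial>lborel) \<partial>lborel)"
  proof (rule nn_integral_cong)
    fix x :: real
    have p: "x^2 + b^2 > 0" using b by (simp add: add_nonneg_pos)
    have "(\<integral>\<^sup>+v. ennreal (x powr s * exp (- (x^2 + b^2) * v)) * indicator {0<..} x * indicator {0<..} v \<partial>lborel)
       = (\<integral>\<^sup>+v. ennreal (x powr s) * indicator {0<..} x * (ennreal (exp (- (x^2 + b^2) * v)) * indicator {0<..} v) \<partial>lborel)"
      by (intro nn_integral_cong) (simp add: ennreal_mult' mult_ac)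
    also have "\<dots> = ennreal (x powr s) * indicator {0<..} x * ennreal (1 / (x^2 + b^2))"
      using nn_integral_exp_scaled[OF p] by (subst nn_integral_cmult) auto
    also have "\<dots> = ennreal (x powr s / (x^2 + b^2)) * indicator {0<..} x"
      using p by (simp add: divide_inverse ennreal_mult' mult_ac)
    finally show "ennreal (x powr s / (x^2 + b^2)) * indicator {0<..} x =
      (\<integral>\<^sup>+v. ennreal (x powr s * exp (- (x^2 + b^2) * v)) * indicator {0<..} x * indicator {0<..} v \<partial>lborel)" ..
  qed
  also have "\<dots> = (\<integral>\<^sup>+v. (\<integral>\<^sup>+x. ennreal (x powr s * exp (- (x^2 + b^2) * v)) * indicator {0<..} x * indicator {0<..} v \<partial>lborel) \<partial>lborel)"
    by (rule lborel_pair.Fubini') measurable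
  also have "\<dots> = (\<integral>\<^sup>+v\<in>{0<..}. ennreal (Gamma ((1+s)/2) / 2) * ennreal (v powr ((1-s)/2 - 1) * exp (- (b^2) * v)) \<partial>lborel)"
  proof (rule nn_integral_cong)
    fix v :: real
    show "(\<integral>\<^sup>+x. ennreal (x powr s * exp (- (x^2 + b^2) * v)) * indicator {0<..} x * indicator {0<..} v \<partial>lborel) =
       ennreal (Gamma ((1+s)/2) / 2) * ennreal (v powr ((1-s)/2 - 1) * exp (- (b^2) * v)) * indicator {0<..} v"
    proof (cases "v > 0")
      case True
      have "(\<integral>\<^sup>+x. ennreal (x powr s * exp (- (x^2 + b^2) * v)) * indicator {0<..} x * indicator {0<..} v \<partial>lborel)
        = (\<integral>\<^sup>+x. ennreal (exp (- (b^2) * v)) * (ennreal (x powr s * exp (- v * x^2)) * indicator {0<..} x) \<partial>lborel)"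
        using True by (intro nn_integral_cong) (simp add: algebra_simps exp_diff exp_minus exp_add field_simps flip: ennreal_mult' mult.assoc)
      also have "\<dots> = ennreal (exp (- (b^2) * v)) * ennreal (Gamma ((s+1)/2) / 2 * v powr (-((s+1)/2)))"
        using nn_integral_Gamma_square[OF s(1) True] by (subst nn_integral_cmult) auto
      also have "-((s+1)/2) = (1-s)/2 - 1" by (simp add: field_simps)
      finally show ?thesis using True s by (simp add: add.commute mult_ac flip: ennreal_mult')
    qed simp
  qed
  also have "\<dots> = ennreal (Gamma ((1+s)/2) / 2) * ennreal (Gamma ((1-s)/2) * (b^2) powr (-((1-s)/2)))"
    using nn_integral_Gamma_scaled[of "(1-s)/2" "b^2"] s b
    by (simp add: mult.assoc nn_integral_cmult)
  also have "(b^2) powr (-((1-s)/2)) = b powr (s - 1)"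
  proof -
    have "(b^2) powr (-((1-s)/2)) = b powr (2 * (-((1-s)/2)))"
      using b by (simp add: powr_powr flip: powr_numeral)
    also have "2 * (-((1-s)/2)) = s - 1" by (simp add: diff_divide_distrib)
    finally show ?thesis .
  qed
  finally show ?thesis using s by (simp add: mult_ac flip: ennreal_mult')
qed

section \<open>First evaluation: geometric series and the trapezoid rule\<close>

text \<open>The coefficient is (1 + exp (-x))/2 minus the integral of exp (-ux) over [0, 1], the
  error of the trapezoid rule. So \<open>planck x\<close> is the sum of the trapezoid errors of t
  \<mapsto> exp (-tx) over all intervals [n, n + 1].\<close>

lemma planck_geometric_sums:
  assumes "x > 0"
  shows "(\<lambda>n. ((1 + exp (-x)) / 2 - (1 - exp (-x)) / x) * exp (- real n * x)) sums planck x"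
proof -
  have e: "exp (-x) < 1" using assms by simp
  have "(\<lambda>n. exp (-x) ^ n) sums (1 / (1 - exp (-x)))"
    using e by (intro geometric_sums) simp
  then have "(\<lambda>n. ((1 + exp (-x)) / 2 - (1 - exp (-x)) / x) * exp (-x) ^ n) sums
     (((1 + exp (-x)) / 2 - (1 - exp (-x)) / x) * (1 / (1 - exp (-x))))"
    by (rule sums_mult)
  also have "((1 + exp (-x)) / 2 - (1 - exp (-x)) / x) * (1 / (1 - exp (-x))) = planck x"
  proof -
    define e where "e = exp (-x)"
    have e: "0 < e" "e < 1" "exp x = 1 / e" using assms by (auto simp: e_def exp_minus field_simps)
    have "1 / (1 / e - 1) + 1/2 = (1 + e) / 2 / (1 - e)"
      using e by (simp add: field_simps)
    moreover have "(A - D / x) * (1 / D) = A / D - 1 / x" if "D \<noteq> 0" for A D :: real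
      using that assms by (simp add: field_simps)
    from this[of "1 - e"] e have "((1 + e) / 2 - (1 - e) / x) * (1 / (1 - e)) = (1 + e) / 2 / (1 - e) - 1 / x"
      by simp
    ultimately show ?thesis unfolding planck_def e(3) e_def[symmetric] by simp
  qed
  also have "(\<lambda>n. exp (-x) ^ n) = (\<lambda>n. exp (- real n * x))"
    by (simp add: fun_eq_iff flip: exp_of_nat_mult)
  finally show ?thesis .
qed

text \<open>Peano kernel form of that trapezoid error: u(1 - u)/2 is integrated against the second
  derivative x^2 exp (-ux). \<open>F\<close> results from integrating by parts twice.\<close>

lemma nn_integral_quadratic_exp:
  assumes "x > (0::real)"
  shows "(\<integral>\<^sup>+u\<in>{0..1}. ennreal (u * (1 - u) / 2 * x^2 * exp (- u * x)) \<partial>lborel)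
     = ennreal ((1 + exp (-x)) / 2 - (1 - exp (-x)) / x)"
proof -
  define F where "F = (\<lambda>u. - (u * (1 - u) / 2 * x * exp (- u * x)) - (1/2 - u) * exp (- u * x) + exp (- u * x) / x)"
  have "(\<integral>\<^sup>+u. ennreal (u * (1 - u) / 2 * x^2 * exp (- u * x)) * indicator {0..1} u \<partial>lborel) = ennreal (F 1 - F 0)"
  proof (rule nn_integral_FTC_Icc)
    show "(F has_real_derivative u * (1 - u) / 2 * x^2 * exp (- u * x)) (at u)" if "u \<in> {0..1}" for u
      unfolding F_def using assms
      by (auto intro!: derivative_eq_intros simp: power2_eq_square field_simps)
    show "0 \<le> u * (1 - u) / 2 * x^2 * exp (- u * x)" if "u \<in> {0..1}" for u using that by auto
  qed auto
  also have "F 1 - F 0 = (1 + exp (-x)) / 2 - (1 - exp (-x)) / x"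
    by (simp add: F_def diff_divide_distrib add_divide_distrib)
  finally show ?thesis .
qed

text \<open>The integrand is t \<mapsto> t^(-s). At n = 0 the convention \<open>0 powr a = 0\<close>
  gives the correct boundary value, as only s < 0 is considered below.\<close>

definition trapezoid_error :: "real \<Rightarrow> nat \<Rightarrow> real" where
  "trapezoid_error s n = (real n powr (-s) + real (Suc n) powr (-s)) / 2
      - (real (Suc n) powr (1 - s) - real n powr (1 - s)) / (1 - s)"

text \<open>The same Peano kernel for t^(-s), whose second derivative is s(s + 1) t^(-s-2). The
  factor s(s + 1) is negative here, so it is the quotient, not \<open>trapezoid_error\<close>
  itself, that is nonnegative.\<close>

lemma nn_integral_trapezoid_error:
  assumes s: "-1 < s" "s < 0"
  shows "(\<integral>\<^sup>+u\<in>{0..1}. ennreal (u * (1 - u) / 2 * (real n + u) powr (-s-2)) \<partial>lborel)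
     = ennreal (trapezoid_error s n / (s * (s + 1)))"
    and "trapezoid_error s n / (s * (s + 1)) \<ge> 0"
proof -
  define f where "f = (\<lambda>u. u * (1 - u) / 2 * (real n + u) powr (-s-2))"
  \<comment> \<open>In terms of v = n + u the kernel is u(1 - u) = -v^2 + (2n + 1) v - n(n + 1), so
    the integrand is a combination of three powers of v.\<close>
  define F where "F = (\<lambda>u. (- ((real n + u) powr (1 - s) / (1 - s)) + (2 * real n + 1) * ((real n + u) powr (- s) / (- s))
       - (real n * (real n + 1)) * ((real n + u) powr (- s - 1) / (- s - 1))) / 2)"
  have d: "(F has_real_derivative f u) (at u)" if "u > 0" for u
  proof -
    define v where "v = real n + u"
    have v: "v > 0" using that by (simp add: v_def)
    have p: "((\<lambda>u. (real n + u) powr a / a) has_real_derivative v powr (a - 1)) (at u)" if "a \<noteq> 0" for a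
      using that v unfolding v_def by (auto intro!: derivative_eq_intros simp: powr_diff)
    have "(F has_real_derivative (- (v powr (1 - s - 1)) + (2 * real n + 1) * v powr (- s - 1)
            - (real n * (real n + 1)) * v powr (- s - 1 - 1)) / 2) (at u)"
      unfolding F_def by (intro DERIV_cdivide DERIV_diff DERIV_add DERIV_minus DERIV_cmult p) (use s in auto)
    also have "(- (v powr (1 - s - 1)) + (2 * real n + 1) * v powr (- s - 1)
            - (real n * (real n + 1)) * v powr (- s - 1 - 1)) / 2 = f u"
    proof -
      have "v powr (1 - s - 1) = v^2 * v powr (-s-2)"
        using v by (simp add: powr_diff powr_numeral)
      moreover have "v powr (-s-1) = v * v powr (-s-2)"
      proof -
        have "1 + (-s-2) = -s-1" by simp
        from powr_add[of v 1 "-s-2", unfolded this] v show ?thesis by (simp add: algebra_simps)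
      qed
      moreover have "v powr (-s-1-1) = v powr (-s-2)" by (simp add: algebra_simps)
      moreover have "u = v - real n" by (simp add: v_def)
      ultimately show ?thesis unfolding f_def v_def[symmetric]
        by (simp only:) (simp add: algebra_simps power2_eq_square)
    qed
    finally show ?thesis .
  qed
  \<comment> \<open>For n = 0 the integrand blows up at u = 0 like u^(-s-1). The unbounded power in
    \<open>F\<close> then carries the coefficient n(n + 1) = 0, so \<open>F\<close> is continuous on
    the closed interval and derivatives inside it suffice.\<close>
  have cont: "continuous_on {0..1} F"
  proof (cases "n = 0")
    case True
    then show ?thesis unfolding F_def using s
      by (auto intro!: continuous_intros continuous_on_powr')
  next
    case False
    then show ?thesis unfolding F_def using s
      by (auto intro!: continuous_intros)
  qed
  have "(f has_integral (F 1 - F 0)) {0..1}"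
    using cont d by (intro fundamental_theorem_of_calculus_interior)
      (auto simp flip: has_real_derivative_iff_has_vector_derivative)
  moreover have f0: "f u \<ge> 0" if "u \<in> {0..1}" for u using that by (auto simp: f_def)
  moreover have val: "F 1 - F 0 = trapezoid_error s n / (s * (s + 1))"
  proof -
    define p where "p = real (Suc n) powr (-s)"
    define q where "q = real n powr (-s)"
    have 1: "real (Suc n) powr (1 - s) = (real n + 1) * p"
      "(real n + 1) * real (Suc n) powr (- s - 1) = p"
      using powr_add[of "real (Suc n)" 1 "-s"] powr_add[of "real (Suc n)" 1 "-s-1"] by (simp_all add: p_def add.commute)
    have 2: "real n powr (1 - s) = real n * q" "real n * real n powr (- s - 1) = q"
      using powr_add[of "real n" 1 "-s"] powr_add[of "real n" 1 "-s-1"] by (cases "n = 0"; simp add: q_def)+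
    have ne: "s \<noteq> 0" "1 - s \<noteq> 0" "s + 1 \<noteq> 0" "-s - 1 \<noteq> 0" using s by auto
    have "F 1 = (- ((real n + 1) * p / (1 - s)) + (2 * real n + 1) * (p / (- s))
       - real n * (((real n + 1) * real (Suc n) powr (- s - 1)) / (- s - 1))) / 2"
      unfolding F_def using 1(1) by (simp add: add.commute p_def)
    also have "\<dots> = (- ((real n + 1) * p / (1 - s)) + (2 * real n + 1) * (p / (- s))
       - real n * (p / (- s - 1))) / 2" unfolding 1(2) ..
    finally have F1: "F 1 = \<dots>" .
    have "F 0 = (- (real n * q / (1 - s)) + (2 * real n + 1) * (q / (- s))
       - (real n + 1) * ((real n * real n powr (- s - 1)) / (- s - 1))) / 2"
      unfolding F_def using 2(1) by (simp add: q_def)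
    also have "\<dots> = (- (real n * q / (1 - s)) + (2 * real n + 1) * (q / (- s))
       - (real n + 1) * (q / (- s - 1))) / 2" unfolding 2(2) ..
    finally have F0: "F 0 = \<dots>" .
    have T: "trapezoid_error s n = (q + p) / 2 - ((real n + 1) * p - real n * q) / (1 - s)"
      unfolding trapezoid_error_def 1 2 p_def q_def ..
    have r: "A / (- s) = - (A / s)" "A / (- s - 1) = - (A / (s + 1))" for A
      using ne by (simp_all add: field_simps)
    show ?thesis unfolding F1 F0 T r using ne by (simp add: divide_simps) (simp add: algebra_simps)
  qed
  ultimately have int: "(f has_integral (trapezoid_error s n / (s * (s + 1)))) {0..1}" by simp
  show "trapezoid_error s n / (s * (s + 1)) \<ge> 0"
    using int f0 by (rule has_integral_nonneg)
  have "(\<integral>\<^sup>+u\<in>{0..1}. ennreal (f u) \<partial>lborel) = (\<integral>\<^sup>+u. ennreal (indicator {0..1} u * f u) \<partial>lborel)"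
    by (intro nn_integral_cong) (auto simp: indicator_def)
  also have "\<dots> = ennreal (trapezoid_error s n / (s * (s + 1)))"
    using nn_integral_has_integral_lebesgue[OF f0 int] by simp
  finally show "(\<integral>\<^sup>+u\<in>{0..1}. ennreal (u * (1 - u) / 2 * (real n + u) powr (-s-2)) \<partial>lborel)
     = ennreal (trapezoid_error s n / (s * (s + 1)))" unfolding f_def .
qed

text \<open>The partial sums are \<open>zeta_em\<close> without its Bernoulli term, and that term
  tends to 0 because s > -1. Starting at n = 0 adds nothing since 0^(-s) and 0^(1-s) vanish.\<close>

lemma trapezoid_error_sums:
  assumes s: "-1 < s" "s < 0"
  shows "trapezoid_error s sums Re (zeta_ext (of_real s))"
proof -
  have part: "(\<Sum>n<N. trapezoid_error s n) = Re (zeta_em N (of_real s) - of_real s / 12 * of_nat N powr (- of_real s - 1))" for N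
  proof -
    have "(\<Sum>n<N. trapezoid_error s n) = (\<Sum>n=1..<N. real n powr (-s)) + real N powr (-s) / 2 - real N powr (1-s) / (1-s)"
    proof (induction N)
      case (Suc N)
      have "(\<Sum>n=1..<Suc N. real n powr (-s)) = (\<Sum>n=1..<N. real n powr (-s)) + real N powr (-s)"
        by (cases "N = 0") auto
      then show ?case using Suc by (simp add: trapezoid_error_def diff_divide_distrib add_divide_distrib)
    qed simp
    also have "\<dots> = Re (of_real \<dots>)" by simp
    also have "complex_of_real ((\<Sum>n=1..<N. real n powr (-s)) + real N powr (-s) / 2 - real N powr (1-s) / (1-s))
       = zeta_em N (of_real s) - of_real s / 12 * of_nat N powr (- of_real s - 1)"
    proof -
      have *: "of_real (real k powr a) = (of_nat k :: complex) powr of_real a" for k a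
        by (simp flip: powr_of_real)
      have **: "A / (1 - complex_of_real s) = - (A / (complex_of_real s - 1))" for A
        by (metis minus_diff_eq minus_divide_right)
      show ?thesis unfolding zeta_em_def by (simp add: * **)
    qed
    finally show ?thesis .
  qed
  have ne: "complex_of_real s \<noteq> 1" "Re (complex_of_real s) > -3" using s by (auto simp: complex_eq_iff)
  have "(\<lambda>N. Re (zeta_em (Suc N) (of_real s) - of_real s / 12 * of_nat (Suc N) powr (- of_real s - 1)))
       \<longlonglongrightarrow> Re (zeta_ext (of_real s) - of_real s / 12 * 0)"
    using s by (intro tendsto_intros zeta_em_LIMSEQ ne of_nat_powr_tendsto_0) auto
  then have "(\<lambda>N. \<Sum>n<Suc N. trapezoid_error s n) \<longlonglongrightarrow> Re (zeta_ext (of_real s))"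
    unfolding part by simp
  then show ?thesis unfolding sums_def by (rule LIMSEQ_imp_Suc)
qed

text \<open>Each trapezoid error of exp (-tx) is written with its Peano kernel. Integrating in x
  first turns x^(s+1) exp (-(n + u) x) into Gamma (s + 2) (n + u)^(-s-2), and the kernel integral in
  u then gives the trapezoid error of t^(-s).\<close>

lemma nn_integral_planck_zeta:
  assumes s: "-1 < s" "s < 0"
  shows "(\<integral>\<^sup>+x\<in>{0<..}. ennreal (planck x * x powr (s - 1)) \<partial>lborel)
     = ennreal (Gamma (s + 2) / (s * (s + 1)) * Re (zeta_ext (of_real s)))"
proof -
  have "(\<integral>\<^sup>+x\<in>{0<..}. ennreal (planck x * x powr (s - 1)) \<partial>lborel)
    = (\<integral>\<^sup>+x. (\<Sum>n. (\<integral>\<^sup>+u. ennreal (u * (1 - u) / 2 * x powr (s + 1) * exp (- (real n + u) * x))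
            * indicator {0..1} u * indicator {0<..} x \<partial>lborel)) \<partial>lborel)"
  proof (rule nn_integral_cong)
    fix x :: real
    show "ennreal (planck x * x powr (s - 1)) * indicator {0<..} x =
       (\<Sum>n. (\<integral>\<^sup>+u. ennreal (u * (1 - u) / 2 * x powr (s + 1) * exp (- (real n + u) * x))
            * indicator {0..1} u * indicator {0<..} x \<partial>lborel))"
    proof (cases "x > 0")
      case True
      define k where "k = (1 + exp (-x)) / 2 - (1 - exp (-x)) / x"
      have "(\<integral>\<^sup>+u. ennreal (u * (1 - u) / 2 * x powr (s + 1) * exp (- (real n + u) * x))
            * indicator {0..1} u * indicator {0<..} x \<partial>lborel) = ennreal (k * exp (- real n * x) * x powr (s - 1))" for n
      proof -
        have "x powr (s + 1) = x powr (s - 1) * x^2"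
        proof -
          have "s - 1 + 2 = s + 1" by simp
          from powr_add[of x "s - 1" 2, unfolded this] True show ?thesis by (simp add: powr_numeral)
        qed
        then have "(\<integral>\<^sup>+u. ennreal (u * (1 - u) / 2 * x powr (s + 1) * exp (- (real n + u) * x))
            * indicator {0..1} u * indicator {0<..} x \<partial>lborel)
          = (\<integral>\<^sup>+u. ennreal (exp (- real n * x) * x powr (s - 1)) *
                (ennreal (u * (1 - u) / 2 * x^2 * exp (- u * x)) * indicator {0..1} u) \<partial>lborel)"
          using True
          by (intro nn_integral_cong)
             (auto simp: indicator_def algebra_simps exp_diff exp_minus field_simps simp flip: ennreal_mult')
        also have "\<dots> = ennreal (exp (- real n * x) * x powr (s - 1)) * ennreal k"
          using nn_integral_quadratic_exp[OF True] unfolding k_def by (subst nn_integral_cmult) auto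
        finally show ?thesis by (subst (asm) ennreal_mult'[symmetric]) (auto simp: mult_ac)
      qed
      \<comment> \<open>The sign is read off from \<open>planck x\<close> > 0, known from the
        partial fractions, since \<open>planck x\<close> is \<open>k\<close> times a sum of
        exponentials.\<close>
      moreover have k: "k \<ge> 0"
      proof -
        have sm: "summable (\<lambda>n. exp (- real n * x))"
          using summable_geometric[of "exp (-x)"] True by (simp flip: exp_of_nat_mult)
        have "0 < planck x"
          using sums_unique[OF planck_partial_fractions[OF True]] 
            suminf_pos[OF sums_summable[OF planck_partial_fractions[OF True]]] True
          by (simp add: add_pos_nonneg)
        moreover have "planck x = k * (\<Sum>n. exp (- real n * x))"
          using sums_unique[OF planck_geometric_sums[OF True], folded k_def] suminf_mult[OF sm, of k] by simp
        moreover have "(\<Sum>n. exp (- real n * x)) \<ge> 0"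
          by (rule suminf_nonneg[OF sm]) simp
        ultimately show ?thesis by (simp add: zero_less_mult_iff) 
      qed
      moreover have "(\<Sum>n. ennreal (k * exp (- real n * x) * x powr (s - 1))) = ennreal (planck x * x powr (s - 1))"
        using k planck_geometric_sums[OF True] unfolding k_def
        by (intro suminf_ennreal_eq sums_mult2 mult_nonneg_nonneg) auto
      ultimately show ?thesis using True by simp
    qed simp
  qed
  also have "\<dots> = (\<Sum>n. \<integral>\<^sup>+x. (\<integral>\<^sup>+u. ennreal (u * (1 - u) / 2 * x powr (s + 1) * exp (- (real n + u) * x))
            * indicator {0..1} u * indicator {0<..} x \<partial>lborel) \<partial>lborel)"
    by (rule nn_integral_suminf) measurable
  also have "\<dots> = (\<Sum>n. \<integral>\<^sup>+u. (\<integral>\<^sup>+x. ennreal (u * (1 - u) / 2 * x powr (s + 1) * exp (- (real n + u) * x))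
            * indicator {0..1} u * indicator {0<..} x \<partial>lborel) \<partial>lborel)"
    by (intro suminf_cong lborel_pair.Fubini'[symmetric]) measurable
  also have "\<dots> = (\<Sum>n. ennreal (Gamma (s + 2) * (trapezoid_error s n / (s * (s + 1)))))"
  proof (intro suminf_cong)
    fix n
    have "(\<integral>\<^sup>+u. (\<integral>\<^sup>+x. ennreal (u * (1 - u) / 2 * x powr (s + 1) * exp (- (real n + u) * x))
            * indicator {0..1} u * indicator {0<..} x \<partial>lborel) \<partial>lborel)
       = (\<integral>\<^sup>+u. ennreal (Gamma (s + 2)) * (ennreal (u * (1 - u) / 2 * (real n + u) powr (-s-2)) * indicator {0..1} u) \<partial>lborel)"
    proof (rule nn_integral_cong)
      fix u :: real
      show "(\<integral>\<^sup>+x. ennreal (u * (1 - u) / 2 * x powr (s + 1) * exp (- (real n + u) * x))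
            * indicator {0..1} u * indicator {0<..} x \<partial>lborel) =
         ennreal (Gamma (s + 2)) * (ennreal (u * (1 - u) / 2 * (real n + u) powr (-s-2)) * indicator {0..1} u)"
      \<comment> \<open>The point u = 0 is set apart because n + u may vanish there; both sides are
        0 by the factor u(1 - u).\<close>
      proof (cases "u \<in> {0<..1}")
        case True
        then have pos: "real n + u > 0" "u * (1 - u) / 2 \<ge> 0" by auto
        have "(\<integral>\<^sup>+x. ennreal (u * (1 - u) / 2 * x powr (s + 1) * exp (- (real n + u) * x))
            * indicator {0..1} u * indicator {0<..} x \<partial>lborel)
          = (\<integral>\<^sup>+x. ennreal (u * (1 - u) / 2) * (ennreal (x powr ((s + 2) - 1) * exp (- (real n + u) * x)) * indicator {0<..} x) \<partial>lborel)"
          using True pos(2) by (intro nn_integral_cong) (simp add: add.commute mult_ac flip: ennreal_mult')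
        also have "\<dots> = ennreal (u * (1 - u) / 2) * ennreal (Gamma (s + 2) * (real n + u) powr (-(s+2)))"
          using nn_integral_Gamma_scaled[of "s + 2" "real n + u"] pos s by (subst nn_integral_cmult) auto
        finally show ?thesis using True pos s by (simp add: mult_ac flip: ennreal_mult')
      qed (auto simp: indicator_def)
    qed
    also have "\<dots> = ennreal (Gamma (s + 2)) * ennreal (trapezoid_error s n / (s * (s + 1)))"
      using nn_integral_trapezoid_error(1)[OF s, of n] by (subst nn_integral_cmult) auto
    also have "\<dots> = ennreal (Gamma (s + 2) * (trapezoid_error s n / (s * (s + 1))))"
      using s by (intro ennreal_mult'[symmetric]) auto
    finally show "(\<integral>\<^sup>+u. (\<integral>\<^sup>+x. ennreal (u * (1 - u) / 2 * x powr (s + 1) * exp (- (real n + u) * x))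
            * indicator {0..1} u * indicator {0<..} x \<partial>lborel) \<partial>lborel)
       = ennreal (Gamma (s + 2) * (trapezoid_error s n / (s * (s + 1))))" .
  qed
  also have "\<dots> = ennreal (Gamma (s + 2) * (Re (zeta_ext (of_real s)) / (s * (s + 1))))"
    using nn_integral_trapezoid_error(2)[OF s] s
    by (intro suminf_ennreal_eq sums_mult sums_divide trapezoid_error_sums mult_nonneg_nonneg) auto
  finally show ?thesis by simp
qed

section \<open>Second evaluation: partial fractions term by term\<close>

text \<open>The partial fraction with b = 2\<pi>(n + 1) integrates to a constant times b^(s-1). As 1
  - s > 1, these powers add up to the Dirichlet series of \<open>zeta_ext\<close> at 1 - s.\<close>

lemma nn_integral_planck_zeta_reflected:
  assumes s: "-1 < s" "s < 0"
  shows "(\<integral>\<^sup>+x\<in>{0<..}. ennreal (planck x * x powr (s - 1)) \<partial>lborel)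
     = ennreal (Gamma ((1+s)/2) * Gamma ((1-s)/2) * (2 * pi) powr (s - 1) * Re (zeta_ext (of_real (1 - s))))"
proof -
  define J where "J = Gamma ((1+s)/2) * Gamma ((1-s)/2)"
  have J: "J > 0" using s by (simp add: J_def)
  have "(\<integral>\<^sup>+x\<in>{0<..}. ennreal (planck x * x powr (s - 1)) \<partial>lborel)
    = (\<integral>\<^sup>+x. (\<Sum>n. ennreal 2 * (ennreal (x powr s / (x^2 + (2 * pi * (real n + 1))^2)) * indicator {0<..} x)) \<partial>lborel)"
  proof (rule nn_integral_cong)
    fix x :: real
    show "ennreal (planck x * x powr (s - 1)) * indicator {0<..} x =
      (\<Sum>n. ennreal 2 * (ennreal (x powr s / (x^2 + (2 * pi * (real n + 1))^2)) * indicator {0<..} x))"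
    proof (cases "x > 0")
      case True
      have "(\<lambda>n. 2 * x / (x^2 + (2 * pi * (real n + 1))^2) * x powr (s - 1)) sums (planck x * x powr (s - 1))"
        by (intro sums_mult2 planck_partial_fractions True)
      also have "(\<lambda>n. 2 * x / (x^2 + (2 * pi * (real n + 1))^2) * x powr (s - 1))
        = (\<lambda>n. 2 * (x powr s / (x^2 + (2 * pi * (real n + 1))^2)))"
        using True by (simp add: powr_diff fun_eq_iff)
      finally have "(\<Sum>n. ennreal (2 * (x powr s / (x^2 + (2 * pi * (real n + 1))^2)))) = ennreal (planck x * x powr (s - 1))"
        by (rule suminf_ennreal_eq[rotated]) simp
      moreover have "ennreal (2 * (x powr s / (x^2 + (2 * pi * (real n + 1))^2)))
          = ennreal 2 * (ennreal (x powr s / (x^2 + (2 * pi * (real n + 1))^2)) * indicator {0<..} x)" for n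
        using True by (subst ennreal_mult') auto
      ultimately show ?thesis using True by simp
    qed simp
  qed
  also have "\<dots> = (\<Sum>n. \<integral>\<^sup>+x. ennreal 2 * (ennreal (x powr s / (x^2 + (2 * pi * (real n + 1))^2)) * indicator {0<..} x) \<partial>lborel)"
    by (rule nn_integral_suminf) measurable
  also have "\<dots> = (\<Sum>n. ennreal (J * (2 * pi) powr (s - 1) * real (Suc n) powr (s - 1)))"
  proof (rule suminf_cong)
    fix n
    have "(\<integral>\<^sup>+x. ennreal 2 * (ennreal (x powr s / (x^2 + (2 * pi * (real n + 1))^2)) * indicator {0<..} x) \<partial>lborel)
      = ennreal 2 * ennreal (J / 2 * (2 * pi * (real n + 1)) powr (s - 1))"
      using nn_integral_powr_over_square[of s "2 * pi * (real n + 1)"] s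
      by (subst nn_integral_cmult) (auto simp: J_def)
    also have "\<dots> = ennreal (J * (2 * pi) powr (s - 1) * real (Suc n) powr (s - 1))"
    proof -
      have "(2 * pi * (real n + 1)) powr (s - 1) = (2 * pi) powr (s - 1) * (real n + 1) powr (s - 1)"
        by (rule powr_mult)
      then show ?thesis
        using J by (subst ennreal_mult'[symmetric]) (auto simp: add.commute mult_ac)
    qed
    finally show "(\<integral>\<^sup>+x. ennreal 2 * (ennreal (x powr s / (x^2 + (2 * pi * (real n + 1))^2)) * indicator {0<..} x) \<partial>lborel)
      = ennreal (J * (2 * pi) powr (s - 1) * real (Suc n) powr (s - 1))" .
  qed
  also have "\<dots> = ennreal (J * (2 * pi) powr (s - 1) * Re (zeta_ext (of_real (1 - s))))"
  proof (intro suminf_ennreal_eq sums_mult)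
    have "(\<lambda>n. Re (of_nat (Suc n) powr - of_real (1 - s))) sums Re (zeta_ext (of_real (1 - s)))"
      using s by (intro sums_Re zeta_ext_sums) auto
    also have "(\<lambda>n. Re (of_nat (Suc n) powr - of_real (1 - s))) = (\<lambda>n. real (Suc n) powr (s - 1))"
    proof
      fix n
      have "(of_nat (Suc n) :: complex) powr - of_real (1 - s) = of_real (real (Suc n)) powr of_real (s - 1)"
        by simp
      also have "\<dots> = of_real (real (Suc n) powr (s - 1))" by (rule powr_of_real) simp
      finally show "Re (of_nat (Suc n) powr - of_real (1 - s)) = real (Suc n) powr (s - 1)" by simp
    qed
    finally show "(\<lambda>n. real (Suc n) powr (s - 1)) sums Re (zeta_ext (of_real (1 - s)))" .
  qed (use J in auto)
  finally show ?thesis unfolding J_def .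
qed

section \<open>The functional equation\<close>

text \<open>Written with \<open>rGamma\<close>, the entire function \<open>1/\<Gamma>\<close>, so that no poles have to be excluded.\<close>
definition zeta_factor :: "complex \<Rightarrow> complex" where
  "zeta_factor s = rGamma ((1 - s) / 2) * of_real pi powr (-s/2)"

lemma zeta_factor_holomorphic: "zeta_factor holomorphic_on A"
  unfolding zeta_factor_def by (intro holomorphic_intros) auto

lemma zeta_factor_nonzero:
  assumes "Re s < 1"
  shows "zeta_factor s \<noteq> 0"
proof -
  have "(1 - s) / 2 \<notin> \<int>\<^sub>\<le>\<^sub>0"
    using assms by (auto elim!: nonpos_Ints_cases simp: complex_eq_iff)
  then show ?thesis by (simp add: zeta_factor_def rGamma_eq_zero_iff)
qed

lemma zeta_factor_cnj: "zeta_factor (cnj s) = cnj (zeta_factor s)"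
  by (simp add: zeta_factor_def cnj_rGamma cnj_powr)

text \<open>Equating the two evaluations gives an asymmetric equation with Gamma s on one side and
  Gamma ((1+s)/2) Gamma ((1-s)/2) on the other. Legendre duplication expresses Gamma s by Gamma
  (s/2) Gamma ((1+s)/2); the common factor cancels and the powers of 2 disappear.\<close>

lemma zeta_ext_functional_equation_real:
  assumes s: "-1 < s" "s < 0"
  shows "zeta_ext (of_real s) * zeta_factor (of_real s) =
         zeta_ext (1 - of_real s) * zeta_factor (1 - of_real s)"
proof -
  define Z where "Z = Re (zeta_ext (of_real s))"
  define Y where "Y = Re (zeta_ext (of_real (1 - s)))"
  have ZY: "zeta_ext (of_real s) = of_real Z" "zeta_ext (1 - of_real s) = of_real Y"
  proof -
    have "cnj (zeta_ext (of_real x)) = zeta_ext (of_real x)" if "x > -3" "x \<noteq> 1" for x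
      using zeta_ext_cnj[of "of_real x"] that by (auto simp: complex_eq_iff)
    then have "zeta_ext (of_real x) = of_real (Re (zeta_ext (of_real x)))" if "x > -3" "x \<noteq> 1" for x
      using that by (simp add: complex_eq_iff)
    from this[of s] this[of "1 - s"] show "zeta_ext (of_real s) = of_real Z" "zeta_ext (1 - of_real s) = of_real Y"
      using s unfolding Z_def Y_def by simp_all
  qed
  define G where "G = (Gamma :: real \<Rightarrow> real)"
  have Gpos: "G x > 0" if "x > 0" for x unfolding G_def using that by simp
  have sh: "s \<notin> \<int>\<^sub>\<le>\<^sub>0" "s/2 \<notin> \<int>\<^sub>\<le>\<^sub>0" "s + 1 \<notin> \<int>\<^sub>\<le>\<^sub>0"
  proof -
    have "x = 0 \<or> x \<le> -1" if "x \<in> \<int>\<^sub>\<le>\<^sub>0" for x :: real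
      using that
    proof (rule nonpos_Ints_cases)
      fix n assume n: "x = of_int n" "n \<le> 0"
      then have "n = 0 \<or> n \<le> -1" by linarith
      then show ?thesis using n(1) by auto
    qed
    from this[of s] this[of "s/2"] this[of "s+1"] s
    show "s \<notin> \<int>\<^sub>\<le>\<^sub>0" "s/2 \<notin> \<int>\<^sub>\<le>\<^sub>0" "s + 1 \<notin> \<int>\<^sub>\<le>\<^sub>0" by auto
  qed
  have "G (s + 2) / (s * (s + 1)) * Z = G ((1+s)/2) * G ((1-s)/2) * (2 * pi) powr (s - 1) * Y"
  proof -
    \<comment> \<open>\<open>ennreal\<close> sends negative reals to 0, so both sides must be shown
      nonnegative before the equation can be read in the reals.\<close>
    have "ennreal (G (s + 2) / (s * (s + 1)) * Z) = ennreal (G ((1+s)/2) * G ((1-s)/2) * (2 * pi) powr (s - 1) * Y)"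
      unfolding G_def Z_def Y_def
      by (rule trans[OF nn_integral_planck_zeta[OF s, symmetric] nn_integral_planck_zeta_reflected[OF s]])
    moreover have "G (s + 2) / (s * (s + 1)) * Z \<ge> 0"
    proof -
      have "(\<lambda>n. trapezoid_error s n / (s * (s + 1))) sums (Z / (s * (s + 1)))"
        unfolding Z_def using s by (intro sums_divide trapezoid_error_sums)
      then have "Z / (s * (s + 1)) \<ge> 0"
        by (rule sums_le[OF nn_integral_trapezoid_error(2)[OF s] sums_zero])
      then have "G (s + 2) * (Z / (s * (s + 1))) \<ge> 0"
        using Gpos[of "s + 2"] s by (intro mult_nonneg_nonneg) auto
      then show ?thesis by simp
    qed
    moreover have "Y \<ge> 0"
    proof -
      have "(\<lambda>n. Re (of_nat (Suc n) powr - of_real (1 - s))) sums Y"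
        unfolding Y_def using s by (intro sums_Re zeta_ext_sums) auto
      moreover have "0 \<le> Re (of_nat (Suc n) powr - of_real (1 - s))" for n
      proof -
        have "(of_nat (Suc n) :: complex) powr - of_real (1 - s) = of_real (real (Suc n)) powr of_real (s - 1)"
          by simp
        also have "\<dots> = of_real (real (Suc n) powr (s - 1))" by (rule powr_of_real) simp
        finally show ?thesis by (simp only: Re_complex_of_real powr_ge_zero)
      qed
      ultimately show ?thesis by (rule sums_le[OF _ sums_zero, rotated])
    qed
    then have "G ((1+s)/2) * G ((1-s)/2) * (2 * pi) powr (s - 1) * Y \<ge> 0"
      using Gpos[of "(1+s)/2"] Gpos[of "(1-s)/2"] s by (intro mult_nonneg_nonneg) auto
    ultimately show ?thesis by (subst (asm) ennreal_inj) auto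
  qed
  moreover have "G (s + 2) = s * (s + 1) * G s"
    using Gamma_plus1[OF sh(3)] Gamma_plus1[OF sh(1)] by (simp add: G_def add.assoc mult_ac)
  ultimately have 1: "G s * Z = G ((1+s)/2) * G ((1-s)/2) * (2 * pi) powr (s - 1) * Y"
    using s by simp
  have dup: "G (s/2) * G ((1+s)/2) = 2 powr (1 - s) * sqrt pi * G s"
  proof -
    have "complex_of_real s / 2 \<notin> \<int>\<^sub>\<le>\<^sub>0" "complex_of_real s / 2 + 1/2 \<notin> \<int>\<^sub>\<le>\<^sub>0"
      using s sh(2) by (auto elim!: nonpos_Ints_cases simp: complex_eq_iff)
    from Gamma_legendre_duplication[OF this]
    have "Gamma (complex_of_real (s/2)) * Gamma (complex_of_real ((1+s)/2)) = 
        exp (of_real ((1 - s) * ln 2)) * of_real (sqrt pi) * Gamma (of_real s)"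
      by (simp add: add_divide_distrib add.commute)
    then have "complex_of_real (G (s/2) * G ((1+s)/2)) = of_real (exp ((1-s) * ln 2) * sqrt pi * G s)"
      unfolding G_def Gamma_complex_of_real exp_of_real by simp
    then have "G (s/2) * G ((1+s)/2) = exp ((1-s) * ln 2) * sqrt pi * G s"
      by (simp only: of_real_eq_iff)
    then show ?thesis by (simp add: powr_def)
  qed
  have "(G (s/2) * Z) * G ((1+s)/2) = 2 powr (1 - s) * sqrt pi * (G s * Z)"
    using dup by (simp add: mult_ac)
  also have "\<dots> = (G ((1-s)/2) * (2 powr (1 - s) * (2 * pi) powr (s - 1) * sqrt pi) * Y) * G ((1+s)/2)"
    unfolding 1 by (simp add: mult_ac)
  finally have "G (s/2) * Z = G ((1-s)/2) * (2 powr (1 - s) * (2 * pi) powr (s - 1) * sqrt pi) * Y"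
    using Gpos[of "(1+s)/2"] s by simp
  also have "2 powr (1 - s) * (2 * pi) powr (s - 1) * sqrt pi = pi powr (s - 1/2)"
  proof -
    have "(2 * pi) powr (s - 1) = 2 powr (s - 1) * pi powr (s - 1)" by (rule powr_mult)
    moreover have "2 powr (1 - s) * 2 powr (s - 1) = (1::real)" by (simp flip: powr_add)
    moreover have "pi powr (s - 1) * sqrt pi = pi powr (s - 1/2)"
      by (simp add: powr_half_sqrt[symmetric] flip: powr_add)
    ultimately show ?thesis by (simp add: mult.assoc[symmetric]) 
  qed
  finally have 2: "G (s/2) * Z = G ((1-s)/2) * pi powr (s - 1/2) * Y" .
  have G0: "G (s/2) \<noteq> 0" "G ((1-s)/2) \<noteq> 0"
    using sh(2) Gpos[of "(1-s)/2"] s by (auto simp: G_def Gamma_eq_zero_iff)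
  have 3: "Z * (inverse (G ((1-s)/2)) * pi powr (-s/2)) = Y * (inverse (G (s/2)) * pi powr (-(1-s)/2))"
  proof -
    have "Z * (inverse (G ((1-s)/2)) * pi powr (-s/2))
        = (G (s/2) * Z) * (inverse (G ((1-s)/2)) * inverse (G (s/2)) * pi powr (-s/2))"
      using G0 by simp
    also have "\<dots> = Y * (inverse (G (s/2)) * (pi powr (s - 1/2) * pi powr (-s/2)))"
      unfolding 2 using G0 by simp
    also have "pi powr (s - 1/2) * pi powr (-s/2) = pi powr (-(1-s)/2)"
      unfolding powr_add[symmetric] by (rule arg_cong[where f="\<lambda>a. pi powr a"]) (simp add: field_simps)
    finally show ?thesis .
  qed
  have fac: "zeta_factor (of_real x) = of_real (inverse (G ((1-x)/2)) * pi powr (-x/2))" for x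
  proof -
    have "zeta_factor (of_real x) = rGamma (of_real ((1-x)/2)) * of_real pi powr of_real (-x/2)"
      unfolding zeta_factor_def by simp
    also have "of_real pi powr of_real (-x/2) = complex_of_real (pi powr (-x/2))"
      by (rule powr_of_real) simp
    finally show ?thesis
      unfolding rGamma_complex_of_real G_def rGamma_inverse_Gamma
      by (simp only: of_real_mult of_real_inverse Gamma_complex_of_real)
  qed
  have "zeta_factor (1 - of_real s) = of_real (inverse (G (s/2)) * pi powr (-(1-s)/2))"
    using fac[of "1 - s"] by simp
  then show ?thesis unfolding ZY fac[of s] using 3
    by (simp only: flip: of_real_mult)
qed

lemma holomorphic_on_reflect:
  assumes "f holomorphic_on A" "\<And>s. s \<in> S \<Longrightarrow> 1 - s \<in> A"
  shows "(\<lambda>s. f (1 - s)) holomorphic_on S"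
proof -
  have "(f \<circ> (\<lambda>s. 1 - s)) holomorphic_on S"
    by (rule holomorphic_on_compose_gen[OF _ assms(1)])
       (use assms(2) in \<open>auto intro: holomorphic_on_diff holomorphic_on_const holomorphic_on_ident\<close>)
  then show ?thesis by (simp add: o_def)
qed

text \<open>The strip is the half-plane Re s > -3 intersected with its image under s \<mapsto> 1 -
  s. Without 0 and 1 it stays connected and both sides are holomorphic on it, so the identity
  theorem extends the equation from (-1, 0).\<close>

lemma zeta_ext_functional_equation:
  assumes "-3 < Re s" "Re s < 4" "s \<noteq> 0" "s \<noteq> 1"
  shows "zeta_ext s * zeta_factor s = zeta_ext (1 - s) * zeta_factor (1 - s)"
proof -
  define S where "S = {z. Re z > -3} \<inter> {z. Re z < 4} - {0, 1}"
  define f where "f = (\<lambda>s. zeta_ext s * zeta_factor s - zeta_ext (1 - s) * zeta_factor (1 - s))"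
  have o: "open ({z. Re z > -3} \<inter> {z. Re z < 4})"
    by (intro open_Int open_halfspace_Re_gt open_halfspace_Re_lt)
  have "f s = 0"
  proof (rule analytic_continuation[of f S "complex_of_real ` {-1<..<0}" "-1/2" s])
    show "open S" unfolding S_def using o by (intro open_Diff) auto
    show "connected S" unfolding S_def
      by (intro connected_open_delete_finite o convex_connected convex_Int convex_halfspace_Re_gt convex_halfspace_Re_lt) auto
    show "f holomorphic_on S"
    proof -
      have "(\<lambda>s. zeta_ext (1 - s)) holomorphic_on S"
        by (rule holomorphic_on_reflect[OF zeta_ext_holomorphic]) (auto simp: S_def complex_eq_iff)
      moreover have "zeta_ext holomorphic_on S"
        by (rule holomorphic_on_subset[OF zeta_ext_holomorphic]) (auto simp: S_def)
      moreover have "(\<lambda>s. zeta_factor (1 - s)) holomorphic_on S"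
        by (rule holomorphic_on_reflect[OF zeta_factor_holomorphic[of UNIV]]) auto
      ultimately show ?thesis unfolding f_def
        by (intro holomorphic_intros zeta_factor_holomorphic)
    qed
    show "of_real ` {-1<..<0} \<subseteq> S" by (auto simp: S_def)
    show "-1/2 \<in> S" by (auto simp: S_def complex_eq_iff)
    show "(-1/2 :: complex) islimpt of_real ` {-1<..<0}"
      unfolding islimpt_approachable
    proof (intro allI impI)
      fix e :: real assume e: "e > 0"
      define x where "x = -1/2 + min (e/2) (1/4)"
      have "x \<in> {-1<..<0}" "x \<noteq> -1/2" "\<bar>x - (-1/2)\<bar> < e" using e by (auto simp: x_def min_def)
      moreover have "dist (complex_of_real x) (-1/2) = \<bar>x - (-1/2)\<bar>"
      proof -
        have "complex_of_real x - (-1/2) = of_real (x - (-1/2))" by simp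
        then show ?thesis unfolding dist_norm by (simp only: norm_of_real)
      qed
      moreover have "complex_of_real x \<noteq> -1/2" using \<open>x \<noteq> -1/2\<close>
        by (metis of_real_eq_iff of_real_divide of_real_minus of_real_1 of_real_numeral)
      ultimately show "\<exists>x'\<in>complex_of_real ` {- 1<..<0}. x' \<noteq> - 1 / 2 \<and> dist x' (- 1 / 2) < e"
        by auto
    qed
    show "f z = 0" if "z \<in> complex_of_real ` {-1<..<0}" for z
      using that zeta_ext_functional_equation_real by (auto simp: f_def)
    show "s \<in> S" using assms by (auto simp: S_def)
  qed
  then show ?thesis by (simp add: f_def)
qed

section \<open>Identification of \<open>zeta\<close> with \<open>zeta_ext\<close>\<close>

text \<open>The definite description needs a witness on the whole punctured plane. \<open>F\<close>
  continues \<open>zeta_ext\<close> to the left by solving the functional equation, which is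
  possible since \<open>zeta_factor\<close> has no zeros for Re s < 1. Uniqueness is continuation
  from Re s > 1, with the value at 1 prescribed.\<close>

lemma zeta_eq_zeta_ext:
  assumes "Re s > -3" "s \<noteq> 1"
  shows "zeta s = zeta_ext s"
proof -
  define F where "F = (\<lambda>s. if s = 1 then 0 else if Re s > -3 then zeta_ext s
      else zeta_ext (1 - s) * zeta_factor (1 - s) / zeta_factor s)"
  let ?P = "\<lambda>f. f holomorphic_on (- {1}) \<and>
     (\<forall>s. Re s > 1 \<longrightarrow> (\<lambda>n. of_nat (Suc n) powr (- s)) sums f s) \<and> f 1 = 0"
  have "F holomorphic_on ({s. Re s > -3} - {1}) \<union> {s. Re s < 0}"
  proof (rule holomorphic_on_Un)
    show "F holomorphic_on ({s. Re s > -3} - {1})"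
      by (rule holomorphic_transform[OF zeta_ext_holomorphic]) (auto simp: F_def)
    have "(\<lambda>s. zeta_ext (1 - s)) holomorphic_on {s. Re s < 0}"
      by (rule holomorphic_on_reflect[OF zeta_ext_holomorphic]) (auto simp: complex_eq_iff)
    moreover have "(\<lambda>s. zeta_factor (1 - s)) holomorphic_on {s. Re s < 0}"
      by (rule holomorphic_on_reflect[OF zeta_factor_holomorphic[of UNIV]]) auto
    ultimately have "(\<lambda>s. zeta_ext (1 - s) * zeta_factor (1 - s) / zeta_factor s) holomorphic_on {s. Re s < 0}"
      by (intro holomorphic_intros zeta_factor_holomorphic) (auto simp: zeta_factor_nonzero)
    then show "F holomorphic_on {s. Re s < 0}"
    proof (rule holomorphic_transform)
      fix s assume s: "s \<in> {s. Re s < 0}"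
      then have "s \<noteq> 1" "s \<noteq> 0" "zeta_factor s \<noteq> 0" by (auto intro!: zeta_factor_nonzero)
      then show "zeta_ext (1 - s) * zeta_factor (1 - s) / zeta_factor s = F s"
        using zeta_ext_functional_equation[of s] s by (auto simp: F_def field_simps)
    qed
    show "open ({s. - 3 < Re s} - {1})" "open {s. Re s < 0}"
      by (intro open_Diff open_halfspace_Re_gt open_halfspace_Re_lt; simp)+
  qed
  also have "({s. Re s > -3} - {1}) \<union> {s. Re s < 0} = - {1}" by auto
  finally have F: "?P F"
    using zeta_ext_sums by (auto simp: F_def)
  have eq: "zeta = F" unfolding zeta_def
  proof (rule the_equality)
    fix f assume f: "?P f"
    show "f = F"
    proof
      fix s show "f s = F s"
      proof (cases "s = 1")
        case False
        show ?thesis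
        proof (rule analytic_continuation_open[of "{s. Re s > 1}" "- {1}" f F])
          show "connected (- {1} :: complex set)" by (rule connected_punctured_universe) simp
          show "{s. Re s > 1} \<noteq> {}" using zeta_ext_sums by (auto intro!: exI[of _ 2])
          show "f z = F z" if "z \<in> {s. Re s > 1}" for z
            using that f F by (auto intro: sums_unique2)
        qed (use f F False in \<open>auto simp: open_halfspace_Re_gt\<close>)
      qed (use f F in auto)
    qed
  qed (rule F)
  show ?thesis unfolding eq using assms by (simp add: F_def)
qed

lemma deriv_zeta_eq_deriv_zeta_ext:
  assumes "Re s > -3" "s \<noteq> 1"
  shows "deriv zeta s = deriv zeta_ext s"
proof (rule deriv_cong_ev[OF _ refl])
  have "open ({s. Re s > -3} - {1})" by (intro open_Diff open_halfspace_Re_gt) auto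
  moreover have "s \<in> {s. Re s > -3} - {1}" using assms by auto
  ultimately have "eventually (\<lambda>z. z \<in> {s. Re s > -3} - {1}) (nhds s)" by (rule eventually_nhds_in_open)
  then show "\<forall>\<^sub>F z in nhds s. zeta z = zeta_ext z"
    by eventually_elim (auto intro: zeta_eq_zeta_ext)
qed

section \<open>The digamma function on the line Re z = 1/4\<close>

lemma ln_one_plus_over_one_minus_bounds:
  assumes "0 < w" "w < (1::real)"
  shows "2 * w \<le> ln ((1 + w) / (1 - w))"
    and "ln ((1 + w) / (1 - w)) \<le> 2 * w + 2 * w^3 / (3 * (1 - w^2))"
proof -
  define x where "x = (1 + w) / (1 - w)"
  have x1: "x > 1" using assms by (simp add: x_def)
  have "(x - 1) / (x + 1) = w" using assms by (simp add: x_def field_simps)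
  then have "ln x \<in> {2 * w .. 2 * w + 2 * w^3 / (3 * (1 - w^2))}"
    using ln_approx_bounds[OF x1, of 1] by (simp add: mult.commute)
  then show "2 * w \<le> ln ((1 + w) / (1 - w))"
    "ln ((1 + w) / (1 - w)) \<le> 2 * w + 2 * w^3 / (3 * (1 - w^2))"
    by (simp_all add: x_def)
qed

text \<open>In the limit formula for \<psi>, ln m is replaced by the asymptotically equal
  \<open>g m\<close>, which telescopes; estimates can then be made term by term. The shift k - 1/4
  centres each difference at u = k + 1/4, and c is left free to be tuned for either bound.\<close>

lemma Re_Digamma_quarter_LIMSEQ:
  assumes "c > -1/16"
  defines "g \<equiv> \<lambda>k. ln ((real k - 1/4)^2 + c) / 2"
  shows "(\<lambda>m. (\<Sum>k<m. (g (Suc k) - g k) - (real k + 1/4) / ((real k + 1/4)^2 + y^2)))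
            \<longlonglongrightarrow> Re (Digamma (Complex (1/4) y)) - ln (1/16 + c) / 2"
proof -
  have "Complex (1/4) y \<noteq> 0" by (simp add: complex_eq_iff)
  from tendsto_Re[OF Digamma_LIMSEQ[OF this]]
  have "(\<lambda>m. ln (real m) - (\<Sum>k<m. Re (inverse (Complex (1/4) y + of_nat k)))) \<longlonglongrightarrow> 
     Re (Digamma (Complex (1/4) y))" by simp
  also have "(\<lambda>k. Re (inverse (Complex (1/4) y + of_nat k)))
       = (\<lambda>k. (real k + 1/4) / ((real k + 1/4)^2 + y^2))"
    by (simp add: fun_eq_iff add.commute)
  finally have 1: "(\<lambda>m. ln (real m) - (\<Sum>k<m. (real k + 1/4) / ((real k + 1/4)^2 + y^2))) \<longlonglongrightarrow> 
     Re (Digamma (Complex (1/4) y))" .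
  have "(\<lambda>m. g m - ln (real m)) \<longlonglongrightarrow> 0" unfolding g_def by real_asymp
  from tendsto_diff[OF tendsto_add[OF 1 this] tendsto_const[of "g 0"]]
  have "(\<lambda>m. g m - g 0 - (\<Sum>k<m. (real k + 1/4) / ((real k + 1/4)^2 + y^2))) \<longlonglongrightarrow>
       Re (Digamma (Complex (1/4) y)) - g 0" by (simp add: algebra_simps)
  moreover have "g 0 = ln (1/16 + c) / 2" unfolding g_def by (simp add: power2_eq_square)
  moreover have "(\<lambda>m. g m - g 0 - (\<Sum>k<m. (real k + 1/4) / ((real k + 1/4)^2 + y^2)))
     = (\<lambda>m. (\<Sum>k<m. (g (Suc k) - g k) - (real k + 1/4) / ((real k + 1/4)^2 + y^2)))"
    by (simp add: fun_eq_iff sum_subtractf[of "\<lambda>k. g (Suc k) - g k"] sum_lessThan_telescope del: sum_subtractf)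
  ultimately show ?thesis by (simp only:)
qed

text \<open>The two quadratics are A + u and A - u, so half the logarithm of their quotient is
  artanh (u/A).\<close>

lemma ln_telescoping_step:
  fixes u c :: real
  assumes "u > 0" "(u - 1/2)^2 + c > 0"
  defines "A \<equiv> u^2 + c + 1/4"
  shows "A > u" "ln ((u + 1/2)^2 + c) / 2 - ln ((u - 1/2)^2 + c) / 2 = ln ((1 + u/A) / (1 - u/A)) / 2"
proof -
  have 1: "(u - 1/2)^2 + c = A - u" "(u + 1/2)^2 + c = A + u"
    unfolding A_def by (simp_all add: power2_eq_square algebra_simps)
  show Au: "A > u" using assms(2) unfolding 1 by simp
  have "(1 + u/A) / (1 - u/A) = (A + u) / (A - u)"
    using Au assms(1) by (simp add: field_simps)
  then show "ln ((u + 1/2)^2 + c) / 2 - ln ((u - 1/2)^2 + c) / 2 = ln ((1 + u/A) / (1 - u/A)) / 2"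
    unfolding 1 using Au assms(1) by (simp add: ln_div diff_divide_distrib)
qed

text \<open>
  With \<open>u = k + 1/4\<close> and \<open>B = u\<^sup>2 + c + 1/4\<close>, the telescoping difference is \<open>artanh (u/B)\<close>, to be compared
  with the series term \<open>u/(u\<^sup>2 + y\<^sup>2)\<close>. For \<open>c = y\<^sup>2 - 1/4\<close> it dominates because \<open>artanh w \<ge> w\<close>; for
  \<open>c = y\<^sup>2 + 1/4\<close> it is dominated.
\<close>
lemma Re_Digamma_quarter_ge:
  assumes "y^2 > 3/16"
  shows "Re (Digamma (Complex (1/4) y)) \<ge> ln (y^2 - 3/16) / 2"
proof -
  define c where "c = y^2 - 1/4"
  have c: "c > -1/16" using assms by (simp add: c_def)
  have "0 \<le> Re (Digamma (Complex (1/4) y)) - ln (1/16 + c) / 2"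
  proof (rule LIMSEQ_le_const[OF Re_Digamma_quarter_LIMSEQ[OF c]], intro exI allI impI sum_nonneg)
    fix k :: nat
    define u where "u = real k + 1/4"
    define A where "A = u^2 + c + 1/4"
    have u: "u > 0" by (simp add: u_def)
    have pos: "(u - 1/2)^2 + c > 0"
    proof (cases k)
      case (Suc j)
      then have "(u - 1/2)^2 \<ge> (1/4)^2" unfolding u_def by (intro power_mono) auto
      then show ?thesis using c by (simp add: power2_eq_square)
    qed (use c in \<open>simp add: u_def power2_eq_square\<close>)
    note st = ln_telescoping_step[OF u pos, folded A_def]
    have "2 * (u/A) \<le> ln ((1 + u/A) / (1 - u/A))"
      using st(1) u by (intro ln_one_plus_over_one_minus_bounds) auto
    moreover have "A = u^2 + y^2" by (simp add: A_def c_def)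
    moreover have uk: "real (Suc k) - 1/4 = u + 1/2" "real k - 1/4 = u - 1/2" by (auto simp: u_def)
    ultimately show "0 \<le> ln ((real (Suc k) - 1/4)^2 + c) / 2 - ln ((real k - 1/4)^2 + c) / 2
        - (real k + 1/4) / ((real k + 1/4)^2 + y^2)"
      using st(2) unfolding uk unfolding u_def[symmetric] by simp
  qed
  then show ?thesis by (simp add: c_def)
qed

lemma Re_Digamma_quarter_le:
  "Re (Digamma (Complex (1/4) y)) \<le> ln (y^2 + 5/16) / 2"
proof -
  define c where "c = y^2 + 1/4"
  have c: "c > -1/16" "c > 0" by (simp_all add: c_def add_nonneg_pos less_le_trans[of _ 0])
  have "Re (Digamma (Complex (1/4) y)) - ln (1/16 + c) / 2 \<le> 0"
  proof (rule LIMSEQ_le_const2[OF Re_Digamma_quarter_LIMSEQ[OF c(1)]], intro exI allI impI sum_nonpos)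
    fix k :: nat
    define u where "u = real k + 1/4"
    define A where "A = u^2 + c + 1/4"
    have u: "u > 0" by (simp add: u_def)
    have pos: "(u - 1/2)^2 + c > 0" using c(2) by (simp add: add_nonneg_pos)
    note st = ln_telescoping_step[OF u pos, folded A_def]
    have "ln ((1 + u/A) / (1 - u/A)) \<le> 2 * (u/A) + 2 * (u/A)^3 / (3 * (1 - (u/A)^2))"
      using st(1) u by (intro ln_one_plus_over_one_minus_bounds) auto
    \<comment> \<open>With A = u^2 + y^2 + 1/2 the available gap is 2u/(A - 1/2) - 2u/A = u/(A(A -
      1/2)). It absorbs the cubic remainder as soon as u^2 (A - 1/2) \<le> 3/2 (A^2 - u^2), and the
      difference of these is a polynomial in u and y with nonnegative even terms.\<close>
    also have "\<dots> \<le> 2 * (u / (u^2 + y^2))"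
    proof -
      have A: "A > 0" using st(1) u by simp
      have A': "A = u^2 + y^2 + 1/2" by (simp add: A_def c_def)
      have d: "A^2 - u^2 > 0" using st(1) u by (simp add: power_strict_mono)
      have "2 * (u/A)^3 / (3 * (1 - (u/A)^2)) = 2 * u^3 / (3 * A * (A^2 - u^2))"
      proof -
        have "(u/A)^3 = u^3 / A^3" "1 - (u/A)^2 = (A^2 - u^2) / A^2"
          using A by (simp_all add: power_divide field_simps)
        then show ?thesis using A d by (simp add: field_simps power2_eq_square power3_eq_cube)
      qed
      also have "\<dots> \<le> 2 * u * (1/2) / (A * (A - 1/2))"
      proof -
        have p: "A - 1/2 > 0" using u by (simp add: A' add_pos_nonneg)
        have "u^2 * (A - 1/2) \<le> 3/2 * (A^2 - u^2)"
        proof -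
          have "3/2 * (A^2 - u^2) - u^2 * (A - 1/2) =
              u^4/2 + 3/2 * y^4 + 2 * (u^2*y^2) + 3/2 * y^2 + 3/8"
            unfolding A' by (simp add: power2_eq_square power4_eq_xxxx algebra_simps)
          also have "\<dots> \<ge> 0" by (intro add_nonneg_nonneg) auto
          finally show ?thesis by simp
        qed
        then have **: "u * (u^2 * (A - 1/2)) \<le> u * (3/2 * (A^2 - u^2))" using u by (intro mult_left_mono) auto
        have *: "2 * u^3 * (A - 1/2) \<le> u * (3 * (A^2 - u^2))"
        proof -
          have "2 * u^3 * (A - 1/2) = 2 * (u * (u^2 * (A - 1/2)))"
            by (simp add: power2_eq_square power3_eq_cube)
          then show ?thesis using ** by linarith
        qed
        have "2 * u^3 / (3 * (A^2 - u^2)) \<le> u / (A - 1/2)"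
          using * p d by (simp add: divide_le_eq le_divide_eq mult.commute mult.left_commute)
        then have "2 * u^3 / (3 * (A^2 - u^2)) / A \<le> u / (A - 1/2) / A"
          using A by (intro divide_right_mono) auto
        then show ?thesis by (simp add: mult_ac)
      qed
      also have "\<dots> = 2 * (u / (u^2 + y^2)) - 2 * (u/A)"
      proof -
        have "B > 0 \<Longrightarrow> 2 * u * (1/2) / ((B + 1/2) * B) = 2 * (u / B) - 2 * (u / (B + 1/2))" for B
          by (simp add: field_simps)
        from this[of "u^2 + y^2"] show ?thesis using u by (simp add: A' add_pos_nonneg add.assoc)
      qed
      finally show ?thesis by simp
    qed
    moreover have uk: "real (Suc k) - 1/4 = u + 1/2" "real k - 1/4 = u - 1/2" by (auto simp: u_def)
    ultimately show "ln ((real (Suc k) - 1/4)^2 + c) / 2 - ln ((real k - 1/4)^2 + c) / 2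
        - (real k + 1/4) / ((real k + 1/4)^2 + y^2) \<le> 0"
      using st(2) unfolding uk unfolding u_def[symmetric] by simp
  qed
  then show ?thesis by (simp add: c_def add.commute)
qed

text \<open>The two bounds place y^2 between \<pi>^2 - 5/16 and \<pi>^2 + 3/16; 3.08 and 3.2 are the
  square roots rounded outwards.\<close>

lemma Re_Digamma_quarter_eq_ln_pi:
  assumes "Re (Digamma (Complex (1/4) y)) = ln pi"
  shows "\<bar>y\<bar> \<in> {3.08..3.2}"
proof -
  have pi2: "9.8 < pi^2" "pi^2 < 9.9"
  proof -
    have "3.141^2 < pi^2" "pi^2 < 3.142^2"
      using pi_approx by (auto intro!: power_strict_mono)
    then show "9.8 < pi^2" "pi^2 < 9.9" by (auto simp: power2_eq_square)
  qed
  have lp: "ln pi = ln (pi^2) / 2" by (simp add: ln_realpow)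
  have "ln (pi^2) \<le> ln (y^2 + 5/16)" using Re_Digamma_quarter_le[of y] assms lp by simp
  then have "pi^2 \<le> y^2 + 5/16" by (subst (asm) ln_le_cancel_iff) (auto simp: add_nonneg_pos)
  then have "y^2 \<ge> 9.4875" using pi2 by simp
  then have 1: "3.08^2 \<le> y^2" by (simp add: power2_eq_square)
  have "y^2 \<le> 3.2^2"
  proof (cases "y^2 > 3/16")
    case True
    then have "ln (y^2 - 3/16) \<le> ln (pi^2)" using Re_Digamma_quarter_ge[of y] assms lp by simp
    then have "y^2 - 3/16 \<le> pi^2" using True by (subst (asm) ln_le_cancel_iff) auto
    then show ?thesis using pi2 by (simp add: power2_eq_square)
  qed (simp add: power2_eq_square)
  then have 2: "\<bar>y\<bar> \<le> 3.2" using abs_le_square_iff[of y "3.2"] by simp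
  have "3.08 \<le> \<bar>y\<bar>" using 1 abs_le_square_iff[of "3.08" y] by simp
  then show ?thesis using 2 by simp
qed

section \<open>The derivative near the exceptional height\<close>

lemma ln_2_3_bounds:
  "ln (2::real) \<in> {0.6931..0.6932}" "ln (3::real) \<in> {1.0986..1.0987}"
  using ln_approx_bounds[of 2 4] ln_approx_bounds[of 3 8]
  by (simp_all add: eval_nat_numeral)

text \<open>Radius 1/2 is the largest for which the disc stays in Re w \<ge> 0, where
  \<open>zeta_ext_tail\<close> applies. N = 4 already brings the error below the lower bound 0.09 of
  \<open>deriv_zeta_em_4_lower_bound\<close>.\<close>

lemma deriv_zeta_ext_approx:
  assumes s: "s = Complex (1/2) t" "6 \<le> t" "t \<le> 6.4"
  shows "norm (deriv zeta_ext s - deriv (zeta_em 4) s) \<le> 0.061"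
proof -
  define A where "A = {s. Re s > -3} - {1::complex}"
  define f where "f = (\<lambda>s. zeta_ext s - zeta_em 4 s)"
  have A: "open A" unfolding A_def by (intro open_Diff open_halfspace_Re_gt) auto
  have hol: "zeta_ext holomorphic_on A" "zeta_em 4 holomorphic_on A"
    unfolding A_def by (rule zeta_ext_holomorphic, rule zeta_em_holomorphic) auto
  then have f: "f holomorphic_on A" unfolding f_def by (intro holomorphic_intros)
  have sA: "s \<in> A" using s by (auto simp: A_def complex_eq_iff)
  have w: "Re w \<ge> 0 \<and> w \<noteq> 1" if "w \<in> cball s (1/2)" for w
  proof -
    have "norm (s - w) \<le> 1/2" using that by (simp add: dist_norm)
    then have "Re (s - w) \<le> 1/2" "Im (s - w) \<le> 1/2"
      using complex_Re_le_cmod[of "s - w"] abs_Im_le_cmod[of "s - w"] by linarith+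
    then have "Re w \<ge> 0" "Im w > 0" using s by simp_all
    then show ?thesis by (auto simp: complex_eq_iff)
  qed
  have sub: "cball s (1/2) \<subseteq> A"
    using w by (force simp: A_def)
  \<comment> \<open>Cauchy's estimate transfers the bound on the tail to its derivative.\<close>
  have "norm ((deriv ^^ 1) f s) \<le> fact 1 * 0.0305 / (1/2) ^ 1"
  proof (rule Cauchy_inequality)
    show "f holomorphic_on ball s (1/2)"
      using f sub by (meson ball_subset_cball holomorphic_on_subset)
    show "continuous_on (cball s (1/2)) f"
      using f sub by (meson holomorphic_on_imp_continuous_on holomorphic_on_subset)
    fix w assume w': "norm (s - w) = 1/2"
    \<comment> \<open>Here c is an upper rounding of |s + k| at t = 6.4, and 1/2 is the radius. The
      four values c + 1/2 give the product bound used below; divided by 2160 * 3.5^3 it is just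
      under 0.0305.\<close>
    have n: "norm (w + of_real k) \<le> c + 1/2" if "(k + 1/2)^2 + 6.4^2 \<le> c^2" "c \<ge> 0" "k \<ge> 0" for k c :: real
    proof -
      have "norm (s + of_real k) \<le> c"
      proof -
        have "(norm (s + of_real k))^2 = (k + 1/2)^2 + t^2"
          unfolding cmod_power2 by (simp add: s(1) add.commute)
        also have "t^2 \<le> 6.4^2" using s by (intro power_mono) auto
        finally have "(norm (s + of_real k))^2 \<le> c^2" using that(1) by simp
        then show ?thesis using that(2) by (rule power2_le_imp_le)
      qed
      moreover have "norm (w + of_real k) \<le> norm (s + of_real k) + norm (s - w)"
        using norm_triangle_ineq4[of "s + of_real k" "s - w"] by (simp add: add.commute)
      ultimately show ?thesis using w' by simp
    qed
    have "norm (f w) \<le> norm (w * (w+1) * (w+2) * (w+3)) / (2160 * (real 4 - 1/2)^3)"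
      unfolding f_def using w[of w] w' by (intro zeta_ext_tail) (auto simp: dist_norm)
    also have "norm (w * (w+1) * (w+2) * (w+3)) \<le> 6.92 * 7.08 * 7.38 * 7.8"
      unfolding norm_mult
      using n[of 0 "6.42"] n[of 1 "6.58"] n[of 2 "6.88"] n[of 3 "7.3"]
      by (intro mult_mono mult_nonneg_nonneg) (simp_all add: power2_eq_square)
    finally show "norm (f w) \<le> 0.0305" by (simp add: divide_right_mono eval_nat_numeral)
  qed simp
  then have "norm (deriv f s) \<le> 0.061" by simp
  also have "deriv f s = deriv zeta_ext s - deriv (zeta_em 4) s"
    unfolding f_def using holomorphic_on_imp_differentiable_at[OF _ A sA] hol by (intro deriv_diff) auto
  finally show ?thesis .
qed

lemma deriv_zeta_em_4:
  fixes s :: complex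
  assumes "s \<noteq> 1"
  defines "a \<equiv> complex_of_real (ln 2)" and "b \<equiv> complex_of_real (ln 3)"
  shows "deriv (zeta_em 4) s = - a * exp (- s * a) - b * exp (- s * b)
     - exp (- s * (2 * a)) * (a + 8 * a / (s - 1) + 4 / (s - 1)^2 - 1/48 + s * a / 24)"
proof (rule DERIV_imp_deriv)
  have ln4: "ln (4::real) = 2 * ln 2" using ln_realpow[of 2 2] by simp
  have pw: "(2::complex) powr z = exp (z * a)" "(3::complex) powr z = exp (z * b)"
    "(4::complex) powr z = exp (z * (2 * a))" for z
    using Ln_of_real[of 2] Ln_of_real[of 3] Ln_of_real[of 4]
    by (simp_all add: powr_def a_def b_def ln4)
  have e4: "exp (2 * a) = 4"
    using ln4 exp_of_real[of "2 * ln 2"] exp_ln[of "4::real"] by (simp add: a_def)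
  define g where "g = (\<lambda>z. 1 + exp (- z * a) + exp (- z * b) + exp (- z * (2 * a)) / 2
     + 4 * exp (- z * (2 * a)) / (z - 1) + z / 48 * exp (- z * (2 * a)))"
  have "zeta_em 4 = g"
  proof
    fix z
    have "(1 - z) * (2 * a) = 2 * a + - z * (2 * a)" "(- z - 1) * (2 * a) = - z * (2 * a) - 2 * a"
      by (simp_all add: algebra_simps)
    then have "exp ((1 - z) * (2 * a)) = 4 * exp (- z * (2 * a))"
      "exp ((- z - 1) * (2 * a)) = exp (- z * (2 * a)) / 4"
      unfolding exp_add exp_diff by (simp_all only: exp_add exp_diff e4)
    moreover have "{1..<4} = {1, 2, 3::nat}" by auto
    ultimately show "zeta_em 4 z = g z" unfolding zeta_em_def g_def by (auto simp: pw mult.commute)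
  qed
  moreover have "(g has_field_derivative - a * exp (- s * a) - b * exp (- s * b)
     - exp (- s * (2 * a)) * (a + 8 * a / (s - 1) + 4 / (s - 1)^2 - 1/48 + s * a / 24)) (at s)"
  proof -
    define e2 e3 e4 where "e2 = exp (- s * a)" and "e3 = exp (- s * b)" and "e4 = exp (- s * (2 * a))"
    have e: "((\<lambda>z. exp (- z * c)) has_field_derivative - c * exp (- s * c)) (at s)" for c
      by (auto intro!: derivative_eq_intros)
    have i: "((\<lambda>z. 1 / (z - 1)) has_field_derivative - 1 / (s - 1)^2) (at s)"
      using assms(1) by (auto intro!: derivative_eq_intros simp: power2_eq_square)
    have g: "g = (\<lambda>z. 1 + exp (- z * a) + exp (- z * b) + exp (- z * (2 * a)) / 2
       + 4 * (exp (- z * (2 * a)) * (1 / (z - 1))) + z / 48 * exp (- z * (2 * a)))"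
      unfolding g_def by (simp add: fun_eq_iff)
    have "(g has_field_derivative 0 + - a * e2 + - b * e3 + - (2 * a) * e4 / 2
       + 4 * (- (2 * a) * e4 * (1 / (s - 1)) + - 1 / (s - 1)^2 * e4)
       + (1 / 48 * e4 + - (2 * a) * e4 * (s / 48))) (at s)"
      unfolding g e2_def e3_def e4_def
      by (intro DERIV_add DERIV_const DERIV_cmult DERIV_mult DERIV_cdivide DERIV_ident e i)
    moreover have "0 + - a * e2 + - b * e3 + - (2 * a) * e4 / 2
       + 4 * (- (2 * a) * e4 * (1 / (s - 1)) + - 1 / (s - 1)^2 * e4)
       + (1 / 48 * e4 + - (2 * a) * e4 * (s / 48))
       = - a * e2 - b * e3 - e4 * (a + 8 * a / (s - 1) + 4 / (s - 1)^2 - 1/48 + s * a / 24)"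
      by (simp add: algebra_simps)
    ultimately show ?thesis unfolding e2_def e3_def e4_def by (simp only:)
  qed
  ultimately show "(zeta_em 4 has_field_derivative - a * exp (- s * a) - b * exp (- s * b)
     - exp (- s * (2 * a)) * (a + 8 * a / (s - 1) + 4 / (s - 1)^2 - 1/48 + s * a / 24)) (at s)"
    by simp
qed

lemma norm_cis_diff_le: "norm (cis x - cis y) \<le> \<bar>x - y\<bar>"
proof -
  have "cis x - cis y = cis y * (cis (x - y) - 1)"
    by (simp add: right_diff_distrib cis_mult)
  then have "norm (cis x - cis y) = norm (cis (x - y) - 1)" by (simp add: norm_mult)
  also have "\<dots> = 2 * \<bar>sin ((x - y) / 2)\<bar>"
    using dist_exp_i_1[of "x - y"] by (simp add: cis_conv_exp)
  also have "\<dots> \<le> \<bar>x - y\<bar>"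
    using abs_sin_x_le_abs_x[of "(x - y) / 2"] by simp
  finally show ?thesis .
qed

lemma cos_ge_parabola: "cos x \<ge> 1 - x^2 / 2" for x :: real
proof -
  have "cos x = 1 - 2 * sin (x/2)^2" using cos_double_sin[of "x/2"] by simp
  moreover have "sin (x/2)^2 \<le> (x/2)^2"
    using abs_sin_x_le_abs_x[of "x/2"] by (simp only: abs_le_square_iff)
  ultimately show ?thesis by (simp add: power_divide)
qed

lemma sin_ge_cubic: "sin x \<ge> x - x^3 / 6" if "x \<ge> 0" for x :: real
proof -
  have "(\<lambda>x. sin x - (x - x^3/6)) 0 \<le> (\<lambda>x. sin x - (x - x^3/6)) x"
  proof (rule DERIV_nonneg_imp_nondecreasing[OF that])
    fix y :: real
    have "((\<lambda>x. sin x - (x - x^3/6)) has_real_derivative cos y - (1 - y^2/2)) (at y)"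
      by (auto intro!: derivative_eq_intros simp: power2_eq_square)
    moreover have "cos y - (1 - y^2/2) \<ge> 0" using cos_ge_parabola[of y] by simp
    ultimately show "\<exists>d. ((\<lambda>x. sin x - (x - x^3/6)) has_real_derivative d) (at y) \<and> 0 \<le> d" by blast
  qed
  then show ?thesis by simp
qed

text \<open>
  Multiplying by \<open>3\<^sup>s\<close> makes the \<open>ln 3\<close> term constant and leaves only the low frequencies \<open>ln (3/2)\<close> and
  \<open>ln (4/3)\<close>, so a single evaluation at height 6.28 controls the whole interval.
\<close>
lemma deriv_zeta_em_4_lower_bound:
  assumes s: "s = Complex (1/2) t" and t: "6.16 \<le> t" "t \<le> 6.4"
  shows "norm (deriv (zeta_em 4) s) > 0.09"
proof -
  define a b where "a = ln (2::real)" and "b = ln (3::real)"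
  have ab: "0.6931 \<le> a" "a \<le> 0.6932" "1.0986 \<le> b" "b \<le> 1.0987"
    using ln_2_3_bounds by (auto simp: a_def b_def)
  define Q where "Q = (\<lambda>v z. of_real a + 8 * of_real a * v + 4 * v^2 - 1/48 + z * of_real a / 24 :: complex)"
  define s0 where "s0 = Complex (1/2) 6.28"
  define v where "v = inverse (s - 1)"
  \<comment> \<open>The exact inverse of -1/2 + 6.28 i, whose squared modulus is 39.6884 =
    99221/2500.\<close>
  define v0 where "v0 = Complex (-1250/99221) (-15700/99221)"
  have v0: "v0 = inverse (s0 - 1)"
  proof -
    have "v0 * (s0 - 1) = 1" by (simp add: v0_def s0_def complex_eq_iff)
    then show ?thesis by (metis inverse_unique mult.commute)
  qed
  \<comment> \<open>On the critical line these are the moduli of (3/2)^s, (3/4)^s and 3^s, that is,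
    the square roots of 3/2, 3/4 and 3.\<close>
  define R1 R2 R3 where "R1 = exp ((b - a) / 2)" and "R2 = exp ((b - 2 * a) / 2)" and "R3 = exp (b / 2)"
  have R: "R1 \<ge> 1.2247" "R1 \<le> 1.2248" "R2 \<ge> 0.866" "R2 \<le> 0.8661" "R3 \<le> 1.7321"
  proof -
    have sq: "R1^2 = 3/2" "R2^2 = 3/4" "R3^2 = 3"
    proof -
      have "exp a = 2" "exp b = 3" by (simp_all add: a_def b_def)
      moreover have "R1^2 = exp (b - a)" "R2^2 = exp (b - 2 * a)" "R3^2 = exp b"
        unfolding R1_def R2_def R3_def by (simp_all flip: exp_double)
      ultimately show "R1^2 = 3/2" "R2^2 = 3/4" "R3^2 = 3"
        by (simp_all add: exp_diff exp_double)
    qed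
    have pos: "R1 > 0" "R2 > 0" "R3 > 0" by (simp_all add: R1_def R2_def R3_def)
    show "R1 \<ge> 1.2247" by (rule power2_le_imp_le) (use sq pos in \<open>simp_all add: power2_eq_square\<close>)
    show "R1 \<le> 1.2248" by (rule power2_le_imp_le) (use sq pos in \<open>simp_all add: power2_eq_square\<close>)
    show "R2 \<ge> 0.866" by (rule power2_le_imp_le) (use sq pos in \<open>simp_all add: power2_eq_square\<close>)
    show "R2 \<le> 0.8661" by (rule power2_le_imp_le) (use sq pos in \<open>simp_all add: power2_eq_square\<close>)
    show "R3 \<le> 1.7321" by (rule power2_le_imp_le) (use sq pos in \<open>simp_all add: power2_eq_square\<close>)
  qed
  \<comment> \<open>3^s times the derivative, with the height in the phases and the coefficient
    \<open>q\<close> as separate arguments, so that both can be frozen at 6.28 and varied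
    independently.\<close>
  define E where "E = (\<lambda>t q. - of_real (a * R1) * cis (t * (b - a)) - of_real b - of_real R2 * cis (- (t * (2 * a - b))) * q)"
  have ez: "exp (s * of_real l) = of_real (exp (l / 2)) * cis (t * l)" for l
    by (subst exp_eq_polar) (simp add: s mult.commute)
  have "exp (s * of_real b) * deriv (zeta_em 4) s = E t (Q v s)"
  proof -
    have "Im s = t" by (simp add: s)
    then have ne: "s \<noteq> 1" using t by auto
    have d: "deriv (zeta_em 4) s = - of_real a * exp (- s * of_real a) - of_real b * exp (- s * of_real b)
          - exp (- s * (2 * of_real a)) * Q v s"
      unfolding deriv_zeta_em_4[OF ne] Q_def v_def a_def b_def divide_inverse power_inverse by (rule refl)
    have m: "exp (s * of_real b) * exp (- s * of_real l) = exp (s * of_real (b - l))" for l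
      by (simp add: algebra_simps flip: exp_add)
    have "exp (s * of_real b) * deriv (zeta_em 4) s
       = - of_real a * (exp (s * of_real b) * exp (- s * of_real a)) - of_real b * (exp (s * of_real b) * exp (- s * of_real b))
          - (exp (s * of_real b) * exp (- s * of_real (2 * a))) * Q v s"
      unfolding d by (simp add: algebra_simps)
    also have "\<dots> = - of_real a * exp (s * of_real (b - a)) - of_real b - exp (s * of_real (b - 2 * a)) * Q v s"
      unfolding m by simp
    also have "\<dots> = E t (Q v s)"
      unfolding ez E_def R1_def R2_def by (simp add: algebra_simps)
    finally show ?thesis .
  qed
  then have "norm (exp (s * of_real b)) * norm (deriv (zeta_em 4) s) = norm (E t (Q v s))"
    by (metis norm_mult)
  moreover have "norm (exp (s * of_real b)) = R3" unfolding ez R3_def by (simp add: norm_mult)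
  ultimately have main: "R3 * norm (deriv (zeta_em 4) s) = norm (E t (Q v s))" by simp
  define q where "q = Q v0 s0"
  have q: "Re q \<ge> 0.517" "Re q \<le> 0.518" "Im q \<ge> -0.681" "Im q \<le> -0.679"
    unfolding q_def Q_def v0_def s0_def using ab by (simp_all add: power2_eq_square)
  have center: "Re (E 6.28 q) \<ge> 0.27"
  proof -
    \<comment> \<open>At height 6.28 the phases lie slightly below \<pi> and slightly above \<pi>/2.
      Their distances \<open>x\<close> and \<open>y\<close> from these angles are small enough for
      the Taylor bounds on cosine and sine.\<close>
    define x where "x = pi - 6.28 * (b - a)"
    define y where "y = 6.28 * (2 * a - b) - pi / 2"
    have x: "0 \<le> x" "x \<le> 0.596" using ab pi_approx unfolding x_def by (simp_all add: field_simps)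
    have y: "0.2345 \<le> y" "y \<le> 0.238" using ab pi_approx unfolding y_def by (simp_all add: field_simps)
    have "x^2 \<le> 0.596^2" using x by (intro power_mono) auto
    then have cx: "cos x \<ge> 0.822" using cos_ge_parabola[of x] by (simp add: power2_eq_square)
    have "y^2 \<le> 0.238^2" "y^3 \<le> 0.238^3" using y by (auto intro!: power_mono)
    then have cy: "cos y \<ge> 0.971" "sin y \<ge> 0.232"
      using cos_ge_parabola[of y] sin_ge_cubic[of y] y by (simp_all add: power2_eq_square power3_eq_cube)
    have "cos (6.28 * (b - a)) = - cos x" unfolding x_def by simp
    moreover have "cos (6.28 * (2 * a - b)) = - sin y" "sin (6.28 * (2 * a - b)) = cos y"
      unfolding y_def by (simp_all add: sin_diff cos_diff)
    ultimately have "Re (E 6.28 q) = a * R1 * cos x - b + R2 * (sin y * Re q - cos y * Im q)"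
      unfolding E_def by (simp add: algebra_simps)
    moreover have "a * R1 * cos x \<ge> 0.6931 * 1.2247 * 0.822"
      using ab R cx by (intro mult_mono) auto
    moreover have "sin y * Re q \<ge> 0.232 * 0.517" using cy q by (intro mult_mono) auto
    moreover have "cos y * (- Im q) \<ge> 0.971 * 0.679" using cy q by (intro mult_mono) auto
    moreover have "R2 * (sin y * Re q - cos y * Im q) \<ge> 0.866 * (0.232 * 0.517 + 0.971 * 0.679)"
      using calculation R by (intro mult_mono) auto
    ultimately show ?thesis using ab by simp
  qed
  have h: "\<bar>t - 6.28\<bar> \<le> 0.12" using t by (simp add: abs_le_iff field_simps)
  have dQ: "norm (Q v s - q) \<le> 0.0251"
  proof -
    have ne: "s - 1 \<noteq> 0" "s0 - 1 \<noteq> 0" using s by (auto simp: s0_def complex_eq_iff)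
    have nv: "norm v \<le> 1 / 6.16" "norm v0 \<le> 1 / 6.28"
    proof -
      have "6.16 \<le> norm (s - 1)" using abs_Im_le_cmod[of "s - 1"] s t by simp
      then have "inverse (norm (s - 1)) \<le> inverse 6.16" by (rule le_imp_inverse_le) simp
      then show "norm v \<le> 1 / 6.16" by (simp add: v_def norm_inverse)
      have "6.28 \<le> norm (s0 - 1)" using abs_Im_le_cmod[of "s0 - 1"] by (simp add: s0_def)
      then have "inverse (norm (s0 - 1)) \<le> inverse 6.28" by (rule le_imp_inverse_le) simp
      then show "norm v0 \<le> 1 / 6.28" by (simp add: v0 norm_inverse)
    qed
    have ss: "norm (s - s0) \<le> 0.12"
    proof -
      have "s - s0 = \<i> * of_real (t - 6.28)" by (simp add: s s0_def complex_eq_iff)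
      then show ?thesis using h by (simp only: norm_mult norm_ii norm_of_real) simp
    qed
    have "v - v0 = - (s - s0) * v * v0"
      unfolding v_def v0 using ne by (simp add: field_simps)
    then have "norm (v - v0) = norm (s - s0) * norm v * norm v0" by (simp only: norm_mult norm_minus_cancel)
    also have "\<dots> \<le> 0.12 * (1/6.16) * (1/6.28)" using ss nv by (intro mult_mono) auto
    finally have vv: "norm (v - v0) \<le> 0.00311" by simp
    have "norm (v + v0) \<le> 1/6.16 + 1/6.28" using norm_triangle_ineq[of v v0] nv by simp
    then have vp: "norm (v + v0) \<le> 0.322" by simp
    have "Q v s - q = of_real (8 * a) * (v - v0) + 4 * ((v - v0) * (v + v0)) + of_real (a / 24) * (s - s0)"
      unfolding q_def Q_def by (simp add: algebra_simps power2_eq_square diff_divide_distrib)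
    also have "norm \<dots> \<le> norm (of_real (8 * a) * (v - v0)) + norm (4 * ((v - v0) * (v + v0))) + norm (of_real (a / 24) * (s - s0))"
      by (intro norm_triangle_le add_right_mono norm_triangle_ineq order_refl)
    also have "\<dots> = 8 * a * norm (v - v0) + 4 * (norm (v - v0) * norm (v + v0)) + a / 24 * norm (s - s0)"
      using ab by (simp add: norm_mult)
    also have "\<dots> \<le> 8 * 0.6932 * 0.00311 + 4 * (0.00311 * 0.322) + 0.6932 / 24 * 0.12"
      using ab vv vp ss by (intro add_mono mult_mono) auto
    finally show ?thesis by simp
  qed
  \<comment> \<open>Three changes add up to just under 0.1: the two phases, each bounded by arc
    length over a height difference of at most 0.12, and the coefficient, bounded by
    \<open>dQ\<close>.\<close>
  have "norm (E t (Q v s) - E 6.28 q) \<le> 0.1"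
  proof -
    define c1 where "c1 = cis (t * (b - a)) - cis (6.28 * (b - a))"
    define c2 where "c2 = cis (- (t * (2 * a - b))) - cis (- (6.28 * (2 * a - b)))"
    have cis: "norm (cis (t * c) - cis (6.28 * c)) \<le> \<bar>t - 6.28\<bar> * \<bar>c\<bar>" for c
      using norm_cis_diff_le[of "t * c" "6.28 * c"] unfolding left_diff_distrib[symmetric] abs_mult .
    have "b - a \<ge> 0" "2 * a - b \<ge> 0" using ab by simp_all
    then have "norm c1 \<le> \<bar>t - 6.28\<bar> * (b - a)" "norm c2 \<le> \<bar>t - 6.28\<bar> * (2 * a - b)"
      using cis[of "b - a"] cis[of "- (2 * a - b)"] unfolding c1_def c2_def
      by (simp_all only: mult_minus_right abs_minus_cancel abs_of_nonneg)
    moreover have "\<bar>t - 6.28\<bar> * (b - a) \<le> 0.12 * 0.4056" "\<bar>t - 6.28\<bar> * (2 * a - b) \<le> 0.12 * 0.2878"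
      by (intro mult_mono; use h ab in simp)+
    ultimately have c: "norm c1 \<le> 0.0487" "norm c2 \<le> 0.0346" by simp_all
    have nq: "norm q \<le> 1.199" using cmod_le[of q] q by simp
    have "E t (Q v s) - E 6.28 q = - of_real (a * R1) * c1 - of_real R2 * (c2 * q + cis (- (t * (2 * a - b))) * (Q v s - q))"
      unfolding E_def c1_def c2_def by (simp add: algebra_simps)
    also have "norm \<dots> \<le> norm (- of_real (a * R1) * c1) + norm (of_real R2 * (c2 * q + cis (- (t * (2 * a - b))) * (Q v s - q)))"
      by (rule norm_triangle_ineq4)
    also have "\<dots> = a * R1 * norm c1 + R2 * norm (c2 * q + cis (- (t * (2 * a - b))) * (Q v s - q))"
      using ab R by (simp add: norm_mult)
    also have "\<dots> \<le> 0.6932 * 1.2248 * 0.0487 + 0.8661 * (0.0346 * 1.199 + 0.0251)"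
    proof (intro add_mono mult_mono)
      have "norm (c2 * q + cis (- (t * (2 * a - b))) * (Q v s - q)) \<le> norm c2 * norm q + norm (Q v s - q)"
        by (rule order_trans[OF norm_triangle_ineq]) (simp add: norm_mult)
      also have "\<dots> \<le> 0.0346 * 1.199 + 0.0251" using c nq dQ by (intro add_mono mult_mono) auto
      finally show "norm (c2 * q + cis (- (t * (2 * a - b))) * (Q v s - q)) \<le> 0.0346 * 1.199 + 0.0251" .
    qed (use ab R c in auto)
    finally show ?thesis by simp
  qed
  then have "Re (E 6.28 q) - Re (E t (Q v s)) \<le> 0.1"
    using complex_Re_le_cmod[of "E 6.28 q - E t (Q v s)"] by (simp add: norm_minus_commute)
  \<comment> \<open>0.27 - 0.1 = 0.17, and dividing by R3 \<le> 1.7321 leaves more than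
    0.09.\<close>
  then have "Re (E t (Q v s)) \<ge> 0.17" using center by simp
  then have "norm (E t (Q v s)) \<ge> 0.17" using complex_Re_le_cmod[of "E t (Q v s)"] by simp
  moreover have "R3 * norm (deriv (zeta_em 4) s) \<le> 1.7321 * norm (deriv (zeta_em 4) s)"
    using R by (intro mult_right_mono) auto
  ultimately show ?thesis using main by simp
qed

lemma deriv_zeta_ext_nonzero:
  assumes "6.16 \<le> t" "t \<le> 6.4"
  shows "deriv zeta_ext (Complex (1/2) t) \<noteq> 0"
  using deriv_zeta_ext_approx[OF refl, of t] deriv_zeta_em_4_lower_bound[OF refl, of t] assms
  by auto

section \<open>The critical line\<close>

lemma Re_Digamma_critical_line:
  assumes \<rho>: "zeta (Complex (1/2) \<rho>) \<noteq> 0" "deriv zeta (Complex (1/2) \<rho>) = 0"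
  shows "Re (Digamma (Complex (1/4) (- \<rho> / 2))) = ln pi"
proof -
  define s where "s = (\<lambda>t. Complex (1/2) t)"
  define \<phi> where "\<phi> = (\<lambda>s. zeta_ext s * zeta_factor s)"
  have s: "Re (s t) > -3" "s t \<noteq> 1" "s t \<noteq> 0" for t by (auto simp: s_def complex_eq_iff)
  have real: "\<phi> (s t) = of_real (Re (\<phi> (s t)))" for t
  proof -
    \<comment> \<open>On the critical line the reflection s \<mapsto> 1 - s is complex conjugation,
      so the functional equation and the conjugation symmetry together say that \<phi> is
      real.\<close>
    have "cnj (s t) = 1 - s t" by (simp add: s_def complex_eq_iff)
    then have "cnj (\<phi> (s t)) = zeta_ext (1 - s t) * zeta_factor (1 - s t)"
      unfolding \<phi>_def using zeta_ext_cnj[OF s(2,1)] zeta_factor_cnj[of "s t"] by (metis complex_cnj_mult)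
    also have "\<dots> = \<phi> (s t)"
      unfolding \<phi>_def by (rule zeta_ext_functional_equation[symmetric]) (use s in \<open>auto simp: s_def complex_eq_iff\<close>)
    finally show ?thesis by (simp add: complex_eq_iff)
  qed
  define w where "w = (1 - s \<rho>) / 2"
  \<comment> \<open>The logarithmic derivative of \<open>zeta_factor\<close> at
    \<open>s \<rho>\<close>. As \<open>zeta_ext\<close> has derivative 0 there, it is also that of
    \<phi>.\<close>
  define L where "L = (Digamma w - of_real (ln pi)) / 2"
  have w: "w = Complex (1/4) (- \<rho> / 2)" by (simp add: w_def s_def complex_eq_iff)
  have wn: "w \<notin> \<int>\<^sub>\<le>\<^sub>0"
    by (auto elim!: nonpos_Ints_cases simp: w complex_eq_iff)
  have dz: "(zeta_ext has_field_derivative 0) (at (s \<rho>))"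
  proof -
    have "zeta_ext field_differentiable at (s \<rho>)"
      by (rule holomorphic_on_imp_differentiable_at[OF zeta_ext_holomorphic])
         (use s in \<open>auto intro!: open_Diff open_halfspace_Re_gt\<close>)
    moreover have "deriv zeta_ext (s \<rho>) = 0"
      using deriv_zeta_eq_deriv_zeta_ext[OF s(1,2), of \<rho>] \<rho>(2) by (simp add: s_def)
    ultimately show ?thesis using field_differentiable_derivI by fastforce
  qed
  have dA: "(zeta_factor has_field_derivative zeta_factor (s \<rho>) * L) (at (s \<rho>))"
  proof -
    have "((\<lambda>z. rGamma ((1 - z) / 2)) has_field_derivative (- rGamma w * Digamma w) * (- 1 / 2)) (at (s \<rho>))"
    proof (rule DERIV_chain2[where f = rGamma and g = "\<lambda>z. (1 - z) / 2"])
      show "(rGamma has_field_derivative - rGamma w * Digamma w) (at ((1 - s \<rho>) / 2))"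
        using has_field_derivative_rGamma_complex'[of w UNIV] wn by (simp add: w_def)
    qed (auto intro!: derivative_eq_intros)
    moreover have "((\<lambda>z. of_real pi powr (- z / 2)) has_field_derivative
        of_real pi powr (- s \<rho> / 2) * of_real (ln pi) * (- 1 / 2)) (at (s \<rho>))"
    proof -
      have "((\<lambda>z. complex_of_real pi powr z) has_field_derivative
          Ln (of_real pi) * of_real pi powr (- s \<rho> / 2)) (at (- s \<rho> / 2))"
        by (rule has_field_derivative_powr_right) simp
      moreover have "((\<lambda>z. - z / 2) has_field_derivative (- 1 / 2)) (at (s \<rho>))"
        by (auto intro!: derivative_eq_intros)
      ultimately have "((\<lambda>z. of_real pi powr (- z / 2)) has_field_derivative
          Ln (of_real pi) * of_real pi powr (- s \<rho> / 2) * (- 1 / 2)) (at (s \<rho>))"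
        by (rule DERIV_chain2)
      then show ?thesis by (simp add: Ln_of_real mult.commute)
    qed
    ultimately have "(zeta_factor has_field_derivative
       (- rGamma w * Digamma w) * (- 1 / 2) * of_real pi powr (- s \<rho> / 2)
       + of_real pi powr (- s \<rho> / 2) * of_real (ln pi) * (- 1 / 2) * rGamma ((1 - s \<rho>) / 2)) (at (s \<rho>))"
      unfolding zeta_factor_def by (rule DERIV_mult)
    then show ?thesis unfolding zeta_factor_def w_def[symmetric] L_def
      by (simp add: algebra_simps diff_divide_distrib)
  qed
  have "(\<phi> has_field_derivative \<phi> (s \<rho>) * L) (at (s \<rho>))"
    unfolding \<phi>_def using DERIV_mult[OF dz dA] by (simp add: mult_ac)
  moreover have "(s has_vector_derivative \<i>) (at \<rho>)"
  proof -
    have "s = (\<lambda>t. 1/2 + t *\<^sub>R \<i>)" by (simp add: s_def fun_eq_iff complex_eq_iff)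
    then show ?thesis by (auto intro!: derivative_eq_intros)
  qed
  ultimately have "((\<phi> \<circ> s) has_vector_derivative \<i> * (\<phi> (s \<rho>) * L)) (at \<rho>)"
    by (rule field_vector_diff_chain_at[rotated])
  then have "((\<lambda>t. Im (\<phi> (s t))) has_vector_derivative Im (\<i> * (\<phi> (s \<rho>) * L))) (at \<rho>)"
    unfolding o_def by (rule bounded_linear.has_vector_derivative[OF bounded_linear_Im])
  moreover have "(\<lambda>t. Im (\<phi> (s t))) = (\<lambda>t. 0)"
    by (rule ext, subst real) simp
  \<comment> \<open>Moving along the line multiplies the derivative by i. The imaginary part of
    \<phi> is constantly 0, so i \<phi> L is real, and since \<phi> is real and nonzero this kills
    Re L.\<close>
  ultimately have 1: "Im (\<i> * (\<phi> (s \<rho>) * L)) = 0"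
    using vector_derivative_unique_at[OF _ has_vector_derivative_const] by metis
  have 2: "Im (\<i> * (\<phi> (s \<rho>) * L)) = Re (\<phi> (s \<rho>)) * Re L"
    by (subst real) simp
  have "\<phi> (s \<rho>) \<noteq> 0"
    unfolding \<phi>_def using \<rho>(1) zeta_eq_zeta_ext[OF s(1,2), of \<rho>] zeta_factor_nonzero[of "s \<rho>"]
    by (simp add: s_def)
  then have "Re (\<phi> (s \<rho>)) \<noteq> 0" using real[of \<rho>] by (metis of_real_0)
  then have "Re L = 0" using trans[OF 2[symmetric] 1] mult_eq_0_iff by blast
  then show ?thesis by (simp add: L_def w)
qed

theorem theorem10p1:
  fixes \<rho> :: real
  assumes "\<rho> \<ge> 0"
    and "cmod (zeta (1/2 + \<i> * of_real \<rho>)) \<noteq> 0"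
  shows "cmod (deriv zeta (1/2 + \<i> * of_real \<rho>)) \<noteq> 0"
proof
  have s: "1/2 + \<i> * of_real \<rho> = Complex (1/2) \<rho>" by (simp add: complex_eq_iff)
  assume "cmod (deriv zeta (1/2 + \<i> * of_real \<rho>)) = 0"
  then have d: "deriv zeta (Complex (1/2) \<rho>) = 0" by (simp add: s)
  have "Re (Digamma (Complex (1/4) (- \<rho> / 2))) = ln pi"
    using Re_Digamma_critical_line[OF _ d] assms(2) by (simp add: s)
  then have "\<bar>- \<rho> / 2\<bar> \<in> {3.08..3.2}" by (rule Re_Digamma_quarter_eq_ln_pi)
  \<comment> \<open>Doubling the interval for |\<rho>/2| gives [6.16, 6.4].\<close>
  then have "deriv zeta_ext (Complex (1/2) \<rho>) \<noteq> 0"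
    using assms(1) by (intro deriv_zeta_ext_nonzero) auto
  moreover have "deriv zeta (Complex (1/2) \<rho>) = deriv zeta_ext (Complex (1/2) \<rho>)"
    by (rule deriv_zeta_eq_deriv_zeta_ext) (auto simp: complex_eq_iff)
  ultimately show False using d by simp
qed

end
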